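(* Let $\pi$ be a group and let $\mathcal{T}$ be a strict T-category over $\pi$. Then the center $\mathcal{Z}(\mathcal{T})$, with the tensor product, components, conjugation and braiding given in its definition, is a braided T-category over $\pi$.
   Context: An object also denotes its identity arrow. **T-categories.** A T-category over $\pi$ is a tensor (monoidal) category $\mathcal{T}$ that is the disjoint union of subcategories $\{\mathcal{T}_\alpha\}_{\alpha\in\pi}$ (no arrows between different components) with $U\otimes V\in\mathcal{T}_{\alpha\beta}$ for $U\in\mathcal{T}_\alpha,V\in\mathcal{T}_\beta$, together with a group homomorphism $\varphi:\pi\to\mathrm{aut}(\mathcal{T})$, $\beta\mapsto\varphi_\beta$ (the conjugation), into the group of invertible strict tensor functors $\mathcal{T}\to\mathcal{T}$, such that $\varphi_\beta(\mathcal{T}_\alpha)=\mathcal{T}_{\beta\alpha\beta^{-1}}$. It is strict if it is strict as a tensor category. For $V\in\mathcal{T}_\beta$ write ${}^V(\cdot)={}^\beta(\cdot)=\varphi_\beta$. **Braiding** (strict case). A family of isomorphisms $c_{U,V}:U\otimes V\to{}^UV\otimes U$ such that $({}^\alpha g\otimes f)\circ c_{U,V}=c_{U',V'}\circ(f\otimes g)$ for $f\in\mathcal{T}_\alpha(U,U')$, $g\in\mathcal{T}(V,V')$; $c_{U\otimes V,W}=(c_{U,{}^VW}\otimes V)\circ(U\otimes c_{V,W})$; $c_{U,V\otimes W}=({}^UV\otimes c_{U,W})\circ(c_{U,V}\otimes W)$; $\varphi_\beta(c_{U,V})=c_{\varphi_\beta(U),\varphi_\beta(V)}$. A braided T-category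 is a T-category with a braiding. **Center.** $\mathcal{Z}(\mathcal{T})$ is defined as follows. Objects (half-braidings): pairs $(U,\mathfrak{c})$ with $U\in\mathcal{T}$ and $\mathfrak{c}$ a natural isomorphism from $U\otimes\_$ to ${}^U(\_)\otimes U$ such that $\mathfrak{c}_{X\otimes Y}=({}^UX\otimes\mathfrak{c}_Y)\circ(\mathfrak{c}_X\otimes Y)$ for all $X,Y$. Arrows $(U,\mathfrak{c})\to(V,\mathfrak{d})$: $f\in\mathcal{T}(U,V)$ with $({}^UX\otimes f)\circ\mathfrak{c}_X=\mathfrak{d}_X\circ(f\otimes X)$ for all $X\in\mathcal{T}$, composed as in $\mathcal{T}$. Tensor product: $(U,\mathfrak{c})\otimes(U',\mathfrak{c}')=(U\otimes U',\mathfrak{c}'')$ with $\mathfrak{c}''_X=(\mathfrak{c}_{{}^{U'}X}\otimes U')\circ(U\otimes\mathfrak{c}'_X)$; on arrows as in $\mathcal{T}$. Tensor unit $(\mathbb{I},\mathrm{Id})$. The $\alpha$-th component is the full subcategory of pairs with $U\in\mathcal{T}_\alpha$. Conjugation: $\varphi_{\mathcal{Z}.\beta}(U,\mathfrak{c})=(\varphi_\beta(U),\varphi_{\mathcal{Z}.\beta}(\mathfrak{c}))$, $\varphi_{\mathcal{Z}.\beta}(\mathfrak{c})_X=\varphi_\beta(\mathfrak{c}_{\varphi_\beta^{-1}(X)})$, and $\varphi_{\mathcal{Z}.\beta}(f)=\varphi_\beta(f)$ on arrows. Braiding: $c_{(U,\mathfrak{c}),(U',\mathfrak{c}')}=\mathfrak{c}_{U'}$.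 *)

theory Defs
  imports "HOL-Algebra.Group" "HOL-Library.FuncSet" "HOL-Library.Disjoint_Sets"
begin

section \<open>Strict tensor categories\<close>

text \<open>
  Objects and arrows are kept in two separate types, and every arrow knows its source and target.
  The operations are total HOL functions whose values matter only on objects, on arrows and on
  composable pairs.  Where the informal text lets an object stand for its identity arrow, the
  identity is written out.
\<close>

record ('o, 'a) tensor_cat =
  Ob :: "'o set"
  Arr :: "'a set"
  Dom :: "'a \<Rightarrow> 'o"
  Cod :: "'a \<Rightarrow> 'o"
  Ide :: "'o \<Rightarrow> 'a"
  Comp :: "'a \<Rightarrow> 'a \<Rightarrow> 'a"  (infixl "\<cdot>\<index>" 65)
  TenO :: "'o \<Rightarrow> 'o \<Rightarrow> 'o"  (infixl "\<boxtimes>\<index>" 75)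
  TenA :: "'a \<Rightarrow> 'a \<Rightarrow> 'a"  (infixl "\<star>\<index>" 75)
  Unit :: "'o"

definition homs :: "('o, 'a, 'm) tensor_cat_scheme \<Rightarrow> 'o \<Rightarrow> 'o \<Rightarrow> 'a set" where
  "homs C U V = {f \<in> Arr C. Dom C f = U \<and> Cod C f = V}"

definition is_iso :: "('o, 'a, 'm) tensor_cat_scheme \<Rightarrow> 'a \<Rightarrow> bool" where
  "is_iso C f \<longleftrightarrow> f \<in> Arr C \<and>
     (\<exists>g \<in> homs C (Cod C f) (Dom C f).
        g \<cdot>\<^bsub>C\<^esub> f = Ide C (Dom C f) \<and> f \<cdot>\<^bsub>C\<^esub> g = Ide C (Cod C f))"

locale category =
  fixes C :: "('o, 'a, 'm) tensor_cat_scheme" (structure)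
  assumes Dom_closed: "f \<in> Arr C \<Longrightarrow> Dom C f \<in> Ob C"
    and Cod_closed: "f \<in> Arr C \<Longrightarrow> Cod C f \<in> Ob C"
    and Ide_homs: "U \<in> Ob C \<Longrightarrow> Ide C U \<in> homs C U U"
    and Comp_homs: "\<lbrakk>f \<in> homs C U V; g \<in> homs C V W\<rbrakk> \<Longrightarrow> g \<cdot> f \<in> homs C U W"
    and Comp_assoc: "\<lbrakk>f \<in> homs C U V; g \<in> homs C V W; h \<in> homs C W X\<rbrakk> \<Longrightarrow>
          (h \<cdot> g) \<cdot> f = h \<cdot> (g \<cdot> f)"
    and Comp_Ide_left: "f \<in> homs C U V \<Longrightarrow> Ide C V \<cdot> f = f"
    and Comp_Ide_right: "f \<in> homs C U V \<Longrightarrow> f \<cdot> Ide C U = f"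

locale strict_tensor_category = category +
  assumes Unit_closed: "Unit C \<in> Ob C"
    and TenO_closed: "\<lbrakk>U \<in> Ob C; V \<in> Ob C\<rbrakk> \<Longrightarrow> U \<boxtimes> V \<in> Ob C"
    and TenA_homs: "\<lbrakk>f \<in> homs C U U'; g \<in> homs C V V'\<rbrakk> \<Longrightarrow>
          f \<star> g \<in> homs C (U \<boxtimes> V) (U' \<boxtimes> V')"
    and TenA_Ide: "\<lbrakk>U \<in> Ob C; V \<in> Ob C\<rbrakk> \<Longrightarrow> Ide C U \<star> Ide C V = Ide C (U \<boxtimes> V)"
    and TenA_Comp: "\<lbrakk>f \<in> homs C U U'; f' \<in> homs C U' U''; g \<in> homs C V V'; g' \<in> homs C V' V''\<rbrakk> \<Longrightarrow>
          (f' \<cdot> f) \<star> (g' \<cdot> g) = (f' \<star> g') \<cdot> (f \<star> g)"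
    and TenO_assoc: "\<lbrakk>U \<in> Ob C; V \<in> Ob C; W \<in> Ob C\<rbrakk> \<Longrightarrow> (U \<boxtimes> V) \<boxtimes> W = U \<boxtimes> (V \<boxtimes> W)"
    and TenA_assoc: "\<lbrakk>f \<in> Arr C; g \<in> Arr C; h \<in> Arr C\<rbrakk> \<Longrightarrow> (f \<star> g) \<star> h = f \<star> (g \<star> h)"
    and TenO_Unit_left: "U \<in> Ob C \<Longrightarrow> Unit C \<boxtimes> U = U"
    and TenO_Unit_right: "U \<in> Ob C \<Longrightarrow> U \<boxtimes> Unit C = U"
    and TenA_Unit_left: "f \<in> Arr C \<Longrightarrow> Ide C (Unit C) \<star> f = f"
    and TenA_Unit_right: "f \<in> Arr C \<Longrightarrow> f \<star> Ide C (Unit C) = f"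


section \<open>Strict tensor automorphisms\<close>

text \<open>
  A functor is a pair of an object map and an arrow map.  Both are extensional, so that equality
  of functors is HOL equality.
\<close>

definition strict_tensor_endos ::
    "('o, 'a, 'm) tensor_cat_scheme \<Rightarrow> (('o \<Rightarrow> 'o) \<times> ('a \<Rightarrow> 'a)) set" where
  "strict_tensor_endos C = {(F, G).
     F \<in> Ob C \<rightarrow>\<^sub>E Ob C \<and> G \<in> Arr C \<rightarrow>\<^sub>E Arr C \<and>
     (\<forall>U V. \<forall>f \<in> homs C U V. G f \<in> homs C (F U) (F V)) \<and>
     (\<forall>U \<in> Ob C. G (Ide C U) = Ide C (F U)) \<and>
     (\<forall>U V W. \<forall>f \<in> homs C U V. \<forall>g \<in> homs C V W. G (g \<cdot>\<^bsub>C\<^esub> f) = G g \<cdot>\<^bsub>C\<^esub> G f) \<and>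
     F (Unit C) = Unit C \<and>
     (\<forall>U \<in> Ob C. \<forall>V \<in> Ob C. F (U \<boxtimes>\<^bsub>C\<^esub> V) = F U \<boxtimes>\<^bsub>C\<^esub> F V) \<and>
     (\<forall>f \<in> Arr C. \<forall>g \<in> Arr C. G (f \<star>\<^bsub>C\<^esub> g) = G f \<star>\<^bsub>C\<^esub> G g)}"

definition endo_monoid ::
    "('o, 'a, 'm) tensor_cat_scheme \<Rightarrow> (('o \<Rightarrow> 'o) \<times> ('a \<Rightarrow> 'a)) monoid" where
  "endo_monoid C =
     \<lparr>carrier = strict_tensor_endos C,
      mult = (\<lambda>(F, G) (F', G'). (compose (Ob C) F F', compose (Arr C) G G')),
      one = (\<lambda>U \<in> Ob C. U, \<lambda>f \<in> Arr C. f)\<rparr>"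

definition aut_group ::
    "('o, 'a, 'm) tensor_cat_scheme \<Rightarrow> (('o \<Rightarrow> 'o) \<times> ('a \<Rightarrow> 'a)) monoid" where
  "aut_group C = units_of (endo_monoid C)"


section \<open>T-categories\<close>

record ('p, 'o, 'a) T_cat = "('o, 'a) tensor_cat" +
  component :: "'p \<Rightarrow> 'o set"
  conjugation :: "'p \<Rightarrow> ('o \<Rightarrow> 'o) \<times> ('a \<Rightarrow> 'a)"

definition component_arr :: "('p, 'o, 'a, 'm) T_cat_scheme \<Rightarrow> 'p \<Rightarrow> 'a set" where
  "component_arr T \<alpha> = {f \<in> Arr T. Dom T f \<in> component T \<alpha> \<and> Cod T f \<in> component T \<alpha>}"

definition conj_ob :: "('p, 'o, 'a, 'm) T_cat_scheme \<Rightarrow> 'p \<Rightarrow> 'o \<Rightarrow> 'o" where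
  "conj_ob T \<beta> = fst (conjugation T \<beta>)"

definition conj_arr :: "('p, 'o, 'a, 'm) T_cat_scheme \<Rightarrow> 'p \<Rightarrow> 'a \<Rightarrow> 'a" where
  "conj_arr T \<beta> = snd (conjugation T \<beta>)"

text \<open>
  A subcategory in a disjoint union is full, hence given by its objects.  The assumption
  \<open>component_arr_Union\<close> says that there are no arrows between different components.
\<close>

locale strict_T_category =
  strict_tensor_category T + group \<pi>
  for \<pi> :: "('p, 'g) monoid_scheme" and T :: "('p, 'o, 'a, 'm) T_cat_scheme" (structure) +
  assumes component_Union: "(\<Union>\<alpha> \<in> carrier \<pi>. component T \<alpha>) = Ob T"
    and component_arr_Union: "(\<Union>\<alpha> \<in> carrier \<pi>. component_arr T \<alpha>) = Arr T"
    and component_disjoint: "disjoint_family_on (component T) (carrier \<pi>)"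
    and component_TenO: "\<lbrakk>\<alpha> \<in> carrier \<pi>; \<beta> \<in> carrier \<pi>; U \<in> component T \<alpha>; V \<in> component T \<beta>\<rbrakk> \<Longrightarrow>
          U \<boxtimes> V \<in> component T (\<alpha> \<otimes>\<^bsub>\<pi>\<^esub> \<beta>)"
    and conjugation_hom: "conjugation T \<in> hom \<pi> (aut_group T)"
    and conj_ob_component: "\<lbrakk>\<alpha> \<in> carrier \<pi>; \<beta> \<in> carrier \<pi>\<rbrakk> \<Longrightarrow>
          conj_ob T \<beta> ` component T \<alpha> = component T (\<beta> \<otimes>\<^bsub>\<pi>\<^esub> \<alpha> \<otimes>\<^bsub>\<pi>\<^esub> inv\<^bsub>\<pi>\<^esub> \<beta>)"
    and conj_arr_component: "\<lbrakk>\<alpha> \<in> carrier \<pi>; \<beta> \<in> carrier \<pi>\<rbrakk> \<Longrightarrow>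
          conj_arr T \<beta> ` component_arr T \<alpha> = component_arr T (\<beta> \<otimes>\<^bsub>\<pi>\<^esub> \<alpha> \<otimes>\<^bsub>\<pi>\<^esub> inv\<^bsub>\<pi>\<^esub> \<beta>)"

definition degree ::
    "('p, 'g) monoid_scheme \<Rightarrow> ('p, 'o, 'a, 'm) T_cat_scheme \<Rightarrow> 'o \<Rightarrow> 'p" where
  "degree \<pi> T U = (THE \<alpha>. \<alpha> \<in> carrier \<pi> \<and> U \<in> component T \<alpha>)"

text \<open>\<open>act_ob \<pi> T U\<close> and \<open>act_arr \<pi> T U\<close> are the object and arrow parts of \<open>\<^sup>U(_)\<close>.\<close>

definition act_ob ::
    "('p, 'g) monoid_scheme \<Rightarrow> ('p, 'o, 'a, 'm) T_cat_scheme \<Rightarrow> 'o \<Rightarrow> 'o \<Rightarrow> 'o" where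
  "act_ob \<pi> T U = conj_ob T (degree \<pi> T U)"

definition act_arr ::
    "('p, 'g) monoid_scheme \<Rightarrow> ('p, 'o, 'a, 'm) T_cat_scheme \<Rightarrow> 'o \<Rightarrow> 'a \<Rightarrow> 'a" where
  "act_arr \<pi> T U = conj_arr T (degree \<pi> T U)"

locale braided_T_category =
  strict_T_category \<pi> T
  for \<pi> :: "('p, 'g) monoid_scheme" and T :: "('p, 'o, 'a, 'm) T_cat_scheme" (structure) +
  fixes c :: "'o \<Rightarrow> 'o \<Rightarrow> 'a"
  assumes braiding_homs: "\<lbrakk>U \<in> Ob T; V \<in> Ob T\<rbrakk> \<Longrightarrow>
          c U V \<in> homs T (U \<boxtimes> V) (act_ob \<pi> T U V \<boxtimes> U)"
    and braiding_iso: "\<lbrakk>U \<in> Ob T; V \<in> Ob T\<rbrakk> \<Longrightarrow> is_iso T (c U V)"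
    and braiding_natural: "\<lbrakk>\<alpha> \<in> carrier \<pi>; U \<in> component T \<alpha>; U' \<in> component T \<alpha>;
          f \<in> homs T U U'; g \<in> homs T V V'\<rbrakk> \<Longrightarrow>
          (conj_arr T \<alpha> g \<star> f) \<cdot> c U V = c U' V' \<cdot> (f \<star> g)"
    and braiding_TenO_left: "\<lbrakk>U \<in> Ob T; V \<in> Ob T; W \<in> Ob T\<rbrakk> \<Longrightarrow>
          c (U \<boxtimes> V) W = (c U (act_ob \<pi> T V W) \<star> Ide T V) \<cdot> (Ide T U \<star> c V W)"
    and braiding_TenO_right: "\<lbrakk>U \<in> Ob T; V \<in> Ob T; W \<in> Ob T\<rbrakk> \<Longrightarrow>
          c U (V \<boxtimes> W) = (Ide T (act_ob \<pi> T U V) \<star> c U W) \<cdot> (c U V \<star> Ide T W)"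
    and braiding_conj: "\<lbrakk>\<beta> \<in> carrier \<pi>; U \<in> Ob T; V \<in> Ob T\<rbrakk> \<Longrightarrow>
          conj_arr T \<beta> (c U V) = c (conj_ob T \<beta> U) (conj_ob T \<beta> V)"


section \<open>The center\<close>

text \<open>
  A half-braiding \<open>c\<close> is an extensional family indexed by the objects, so that pairs \<open>(U, c)\<close>
  are equal in HOL exactly when they are equal as objects of the center.
\<close>

definition half_braiding ::
    "('p, 'g) monoid_scheme \<Rightarrow> ('p, 'o, 'a, 'm) T_cat_scheme \<Rightarrow> 'o \<Rightarrow> ('o \<Rightarrow> 'a) \<Rightarrow> bool" where
  "half_braiding \<pi> T U c \<longleftrightarrow>
     U \<in> Ob T \<and> c \<in> extensional (Ob T) \<and>
     (\<forall>X \<in> Ob T. c X \<in> homs T (U \<boxtimes>\<^bsub>T\<^esub> X) (act_ob \<pi> T U X \<boxtimes>\<^bsub>T\<^esub> U) \<and> is_iso T (c X)) \<and>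
     (\<forall>X Y. \<forall>g \<in> homs T X Y.
        (act_arr \<pi> T U g \<star>\<^bsub>T\<^esub> Ide T U) \<cdot>\<^bsub>T\<^esub> c X = c Y \<cdot>\<^bsub>T\<^esub> (Ide T U \<star>\<^bsub>T\<^esub> g)) \<and>
     (\<forall>X \<in> Ob T. \<forall>Y \<in> Ob T.
        c (X \<boxtimes>\<^bsub>T\<^esub> Y) =
          (Ide T (act_ob \<pi> T U X) \<star>\<^bsub>T\<^esub> c Y) \<cdot>\<^bsub>T\<^esub> (c X \<star>\<^bsub>T\<^esub> Ide T Y))"

type_synonym ('o, 'a) center_ob = "'o \<times> ('o \<Rightarrow> 'a)"

text \<open>
  One arrow of \<open>T\<close> may underlie arrows between several pairs of half-braidings, so an arrow of the
  center is a triple of source, underlying arrow and target.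
\<close>

type_synonym ('o, 'a) center_arr = "('o, 'a) center_ob \<times> 'a \<times> ('o, 'a) center_ob"

definition center_Ob ::
    "('p, 'g) monoid_scheme \<Rightarrow> ('p, 'o, 'a, 'm) T_cat_scheme \<Rightarrow> ('o, 'a) center_ob set" where
  "center_Ob \<pi> T = {(U, c). half_braiding \<pi> T U c}"

definition center_Arr ::
    "('p, 'g) monoid_scheme \<Rightarrow> ('p, 'o, 'a, 'm) T_cat_scheme \<Rightarrow> ('o, 'a) center_arr set" where
  "center_Arr \<pi> T = {((U, c), f, (V, d)).
     half_braiding \<pi> T U c \<and> half_braiding \<pi> T V d \<and> f \<in> homs T U V \<and>
     (\<forall>X \<in> Ob T. (Ide T (act_ob \<pi> T U X) \<star>\<^bsub>T\<^esub> f) \<cdot>\<^bsub>T\<^esub> c X = d X \<cdot>\<^bsub>T\<^esub> (f \<star>\<^bsub>T\<^esub> Ide T X))}"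

definition center_TenO ::
    "('p, 'g) monoid_scheme \<Rightarrow> ('p, 'o, 'a, 'm) T_cat_scheme \<Rightarrow>
     ('o, 'a) center_ob \<Rightarrow> ('o, 'a) center_ob \<Rightarrow> ('o, 'a) center_ob" where
  "center_TenO \<pi> T = (\<lambda>(U, c) (U', c').
     (U \<boxtimes>\<^bsub>T\<^esub> U',
      \<lambda>X \<in> Ob T. (c (act_ob \<pi> T U' X) \<star>\<^bsub>T\<^esub> Ide T U') \<cdot>\<^bsub>T\<^esub> (Ide T U \<star>\<^bsub>T\<^esub> c' X)))"

definition center_conj_ob ::
    "('p, 'o, 'a, 'm) T_cat_scheme \<Rightarrow> 'p \<Rightarrow> ('o, 'a) center_ob \<Rightarrow> ('o, 'a) center_ob" where
  "center_conj_ob T \<beta> = (\<lambda>(U, c).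
     (conj_ob T \<beta> U,
      \<lambda>X \<in> Ob T. conj_arr T \<beta> (c (fst (inv\<^bsub>aut_group T\<^esub> (conjugation T \<beta>)) X))))"

definition center ::
    "('p, 'g) monoid_scheme \<Rightarrow> ('p, 'o, 'a, 'm) T_cat_scheme \<Rightarrow>
     ('p, ('o, 'a) center_ob, ('o, 'a) center_arr) T_cat" where
  "center \<pi> T =
     \<lparr>Ob = center_Ob \<pi> T,
      Arr = center_Arr \<pi> T,
      Dom = (\<lambda>(A, f, B). A),
      Cod = (\<lambda>(A, f, B). B),
      Ide = (\<lambda>A. (A, Ide T (fst A), A)),
      Comp = (\<lambda>(B', g, D) (A, f, B). (A, g \<cdot>\<^bsub>T\<^esub> f, D)),
      TenO = center_TenO \<pi> T,
      TenA = (\<lambda>(A, f, B) (A', f', B'). (center_TenO \<pi> T A A', f \<star>\<^bsub>T\<^esub> f', center_TenO \<pi> T B B')),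
      Unit = (Unit T, \<lambda>X \<in> Ob T. Ide T X),
      component = (\<lambda>\<alpha>. {(U, c). half_braiding \<pi> T U c \<and> U \<in> component T \<alpha>}),
      conjugation = (\<lambda>\<beta>.
        (\<lambda>A \<in> center_Ob \<pi> T. center_conj_ob T \<beta> A,
         \<lambda>(A, f, B) \<in> center_Arr \<pi> T. (center_conj_ob T \<beta> A, conj_arr T \<beta> f, center_conj_ob T \<beta> B)))\<rparr>"

definition center_braiding ::
    "('p, 'g) monoid_scheme \<Rightarrow> ('p, 'o, 'a, 'm) T_cat_scheme \<Rightarrow>
     ('o, 'a) center_ob \<Rightarrow> ('o, 'a) center_ob \<Rightarrow> ('o, 'a) center_arr" where
  "center_braiding \<pi> T A B =
     (A \<boxtimes>\<^bsub>center \<pi> T\<^esub> B,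
      snd A (fst B),
      act_ob \<pi> (center \<pi> T) A B \<boxtimes>\<^bsub>center \<pi> T\<^esub> A)"

end

theory Submission
  imports Defs
begin

text \<open>
  Since the degree is multiplicative, \<open>\<^sup>U(\<^sup>V(_))\<close> is the action of \<open>U \<otimes> V\<close>, and the composite of
  half-braidings \<open>c\<close> on \<open>U\<close> and \<open>d\<close> on \<open>V\<close> is again a half-braiding: in the hexagon at
  \<open>X \<otimes> Y\<close> the two middle factors involve \<open>c\<close> at \<open>\<^sup>VX\<close> and \<open>d\<close> at \<open>Y\<close>, which commute by the
  interchange law.  A half-braiding, evaluated at the object underlying another one, is an arrow
  of the center by its own naturality and hexagon, and its inverse in \<open>T\<close> is then an arrow of the
  center too.  The two hexagons of the resulting braiding are the definition of the tensor product
  of half-braidings and the hexagon satisfied by each half-braiding.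
\<close>

section \<open>Strict tensor categories\<close>

text \<open>An arrow of the center carries its source and target, so every equation of arrows also
  asserts that certain half-braidings are equal as functions. The associativity, unit and
  conjugation laws must therefore hold for the families themselves, and extensionality settles their
  values outside the objects. The action of \<open>U\<close> depends only on its degree, and arrows
  preserve the degree, so the same conjugation is used at both ends of an arrow. Conjugating a
  half-braiding \<open>c\<close> on \<open>U\<close> by \<open>\<beta>\<close> has to shift its
  index: \<open>\<phi>_\<beta>(c_Y)\<close> starts at
  \<open>\<phi>_\<beta>(U) \<otimes> \<phi>_\<beta>(Y)\<close>, so the value at \<open>X\<close> is
  taken at \<open>Y = \<phi>_\<beta>^{-1}(X)\<close>. With \<open>u\<close> the degree of
  \<open>U\<close>, the degree \<open>\<beta> u \<beta>^{-1}\<close> of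
  \<open>\<phi>_\<beta>(U)\<close> then moves \<open>X\<close> exactly to
  \<open>\<phi>_\<beta>(\<phi>_u(Y))\<close>.\<close>

context category
begin

lemma is_isoI:
  "\<lbrakk>f \<in> homs C U V; g \<in> homs C V U; g \<cdot> f = Ide C U; f \<cdot> g = Ide C V\<rbrakk> \<Longrightarrow> is_iso C f"
  by (auto simp: is_iso_def homs_def)

lemma is_isoE:
  assumes "is_iso C f" "f \<in> homs C U V"
  obtains g where "g \<in> homs C V U" "g \<cdot> f = Ide C U" "f \<cdot> g = Ide C V"
  using assms by (auto simp: is_iso_def homs_def)

lemma Ide_Arr [simp]: "U \<in> Ob C \<Longrightarrow> Ide C U \<in> Arr C"
  and Dom_Ide [simp]: "U \<in> Ob C \<Longrightarrow> Dom C (Ide C U) = U"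
  and Cod_Ide [simp]: "U \<in> Ob C \<Longrightarrow> Cod C (Ide C U) = U"
  using Ide_homs[of U] by (auto simp: homs_def)

text \<open>Typing by \<open>Arr\<close>, \<open>Dom\<close> and \<open>Cod\<close> instead of hom
  sets leaves no intermediate objects to guess, so the simplifier itself can check that arrows
  compose.\<close>

lemma
  assumes "f \<in> Arr C" "g \<in> Arr C" "Dom C g = Cod C f"
  shows Comp_Arr [simp]: "g \<cdot> f \<in> Arr C"
    and Dom_Comp [simp]: "Dom C (g \<cdot> f) = Dom C f"
    and Cod_Comp [simp]: "Cod C (g \<cdot> f) = Cod C g"
  using Comp_homs[of f "Dom C f" "Cod C f" g "Cod C g"] assms by (auto simp: homs_def)

lemma Comp_assoc_Arr:
  "\<lbrakk>f \<in> Arr C; g \<in> Arr C; h \<in> Arr C; Dom C g = Cod C f; Dom C h = Cod C g\<rbrakk> \<Longrightarrow>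
    (h \<cdot> g) \<cdot> f = h \<cdot> (g \<cdot> f)"
  using Comp_assoc[of f "Dom C f" "Cod C f" g "Cod C g" h "Cod C h"] by (auto simp: homs_def)

lemma Comp_Ide_left_Arr [simp]: "\<lbrakk>f \<in> Arr C; Cod C f = V\<rbrakk> \<Longrightarrow> Ide C V \<cdot> f = f"
  using Comp_Ide_left[of f "Dom C f" "Cod C f"] by (auto simp: homs_def)

lemma Comp_Ide_right_Arr [simp]: "\<lbrakk>f \<in> Arr C; Dom C f = V\<rbrakk> \<Longrightarrow> f \<cdot> Ide C V = f"
  using Comp_Ide_right[of f "Dom C f" "Cod C f"] by (auto simp: homs_def)

text \<open>In right-nested composites an equation between two-factor composites no longer matches
  once a further factor \<open>h\<close> stands to their right; this form supplies the
  match.\<close>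

lemma Comp_eq_extend:
  assumes "g \<cdot> f = g' \<cdot> f'"
    and "h \<in> Arr C" "f \<in> Arr C" "g \<in> Arr C" "f' \<in> Arr C" "g' \<in> Arr C"
    and "Dom C g = Cod C f" "Dom C g' = Cod C f'" "Dom C f = Cod C h" "Dom C f' = Cod C h"
  shows "g \<cdot> (f \<cdot> h) = g' \<cdot> (f' \<cdot> h)"
  using assms by (simp flip: Comp_assoc_Arr)

lemma is_iso_Comp:
  assumes "is_iso C f" "is_iso C g" "Dom C g = Cod C f"
  shows "is_iso C (g \<cdot> f)"
proof -
  have A: "f \<in> Arr C" "g \<in> Arr C" using assms by (auto simp: is_iso_def)
  obtain f' where f': "f' \<in> homs C (Cod C f) (Dom C f)" "f' \<cdot> f = Ide C (Dom C f)"
      "f \<cdot> f' = Ide C (Cod C f)"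
    using assms by (auto simp: is_iso_def)
  obtain g' where g': "g' \<in> homs C (Cod C g) (Dom C g)" "g' \<cdot> g = Ide C (Dom C g)"
      "g \<cdot> g' = Ide C (Cod C g)"
    using assms by (auto simp: is_iso_def)
  have [simp]: "f' \<in> Arr C" "g' \<in> Arr C" "Dom C f' = Cod C f" "Cod C f' = Dom C f"
      "Dom C g' = Cod C g" "Cod C g' = Cod C f"
    using f' g' assms by (auto simp: homs_def)
  have 1: "(f' \<cdot> g') \<cdot> (g \<cdot> f) = f' \<cdot> ((g' \<cdot> g) \<cdot> f)"
    using A assms by (simp add: Comp_assoc_Arr)
  have 2: "(g \<cdot> f) \<cdot> (f' \<cdot> g') = g \<cdot> ((f \<cdot> f') \<cdot> g')"
    using A assms by (simp add: Comp_assoc_Arr)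
  show ?thesis
  proof (rule is_isoI)
    show "g \<cdot> f \<in> homs C (Dom C f) (Cod C g)" using A assms by (simp add: homs_def)
    show "f' \<cdot> g' \<in> homs C (Cod C g) (Dom C f)" by (simp add: homs_def)
    show "(f' \<cdot> g') \<cdot> (g \<cdot> f) = Ide C (Dom C f)"
      using A assms f' g' by (simp add: 1)
    show "(g \<cdot> f) \<cdot> (f' \<cdot> g') = Ide C (Cod C g)"
      using A assms f' g' by (simp add: 2)
  qed
qed

lemma is_iso_Ide: "U \<in> Ob C \<Longrightarrow> is_iso C (Ide C U)"
  by (rule is_isoI[of _ U U "Ide C U"]) (auto simp: homs_def)

end

context strict_tensor_category
begin

declare Dom_closed [simp] Cod_closed [simp] Unit_closed [simp] TenO_closed [simp]
  TenO_Unit_left [simp] TenO_Unit_right [simp] TenA_Unit_left [simp] TenA_Unit_right [simp]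

lemma
  assumes "f \<in> Arr C" "g \<in> Arr C"
  shows TenA_Arr [simp]: "f \<star> g \<in> Arr C"
    and Dom_TenA [simp]: "Dom C (f \<star> g) = Dom C f \<boxtimes> Dom C g"
    and Cod_TenA [simp]: "Cod C (f \<star> g) = Cod C f \<boxtimes> Cod C g"
  using TenA_homs[of f "Dom C f" "Cod C f" g "Dom C g" "Cod C g"] assms by (auto simp: homs_def)

lemma TenA_Comp_Arr:
  "\<lbrakk>f \<in> Arr C; f' \<in> Arr C; g \<in> Arr C; g' \<in> Arr C; Dom C f' = Cod C f; Dom C g' = Cod C g\<rbrakk> \<Longrightarrow>
    (f' \<cdot> f) \<star> (g' \<cdot> g) = (f' \<star> g') \<cdot> (f \<star> g)"
  using TenA_Comp[of f "Dom C f" "Cod C f" f' "Cod C f'" g "Dom C g" "Cod C g" g' "Cod C g'"]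
  by (auto simp: homs_def)

lemma whisker_left:
  "\<lbrakk>f \<in> Arr C; g \<in> Arr C; Dom C g = Cod C f; X \<in> Ob C\<rbrakk> \<Longrightarrow>
    Ide C X \<star> (g \<cdot> f) = (Ide C X \<star> g) \<cdot> (Ide C X \<star> f)"
  using TenA_Comp_Arr[of "Ide C X" "Ide C X" f g] by simp

lemma whisker_right:
  "\<lbrakk>f \<in> Arr C; g \<in> Arr C; Dom C g = Cod C f; X \<in> Ob C\<rbrakk> \<Longrightarrow>
    (g \<cdot> f) \<star> Ide C X = (g \<star> Ide C X) \<cdot> (f \<star> Ide C X)"
  using TenA_Comp_Arr[of f g "Ide C X" "Ide C X"] by simp

text \<open>Together with \<open>interchange_left_first\<close> this lets arrows on different tensor
  factors be applied in either order, both composites being \<open>f \<star> g\<close>.\<close>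

lemma interchange_right_first:
  "\<lbrakk>f \<in> Arr C; g \<in> Arr C; Dom C f = U; Cod C g = V\<rbrakk> \<Longrightarrow>
    (f \<star> Ide C V) \<cdot> (Ide C U \<star> g) = f \<star> g"
  using TenA_Comp_Arr[of "Ide C U" f g "Ide C V"] by auto

lemma interchange_left_first:
  "\<lbrakk>f \<in> Arr C; g \<in> Arr C; Cod C f = U; Dom C g = V\<rbrakk> \<Longrightarrow>
    (Ide C U \<star> g) \<cdot> (f \<star> Ide C V) = f \<star> g"
  using TenA_Comp_Arr[of f "Ide C U" "Ide C V" g] by auto

lemma is_iso_TenA:
  assumes "is_iso C f" "is_iso C g"
  shows "is_iso C (f \<star> g)"
proof -
  have A: "f \<in> Arr C" "g \<in> Arr C" using assms by (auto simp: is_iso_def)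
  obtain f' where f': "f' \<in> homs C (Cod C f) (Dom C f)" "f' \<cdot> f = Ide C (Dom C f)"
      "f \<cdot> f' = Ide C (Cod C f)"
    using assms by (auto simp: is_iso_def)
  obtain g' where g': "g' \<in> homs C (Cod C g) (Dom C g)" "g' \<cdot> g = Ide C (Dom C g)"
      "g \<cdot> g' = Ide C (Cod C g)"
    using assms by (auto simp: is_iso_def)
  have [simp]: "f' \<in> Arr C" "g' \<in> Arr C" "Dom C f' = Cod C f" "Cod C f' = Dom C f"
      "Dom C g' = Cod C g" "Cod C g' = Dom C g"
    using f' g' by (auto simp: homs_def)
  show ?thesis
    by (rule is_isoI[of _ "Dom C f \<boxtimes> Dom C g" "Cod C f \<boxtimes> Cod C g" "f' \<star> g'"])
      (use A f' g' in \<open>simp_all add: homs_def TenA_Comp_Arr[symmetric] TenA_Ide\<close>)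
qed

end


section \<open>Strict tensor automorphisms\<close>

text \<open>Projections replace the pattern match because a functor such as
  \<open>conjugation T \<beta>\<close> is not syntactically a pair.\<close>

lemma strict_tensor_endos_iff:
  "K \<in> strict_tensor_endos C \<longleftrightarrow>
     fst K \<in> Ob C \<rightarrow>\<^sub>E Ob C \<and> snd K \<in> Arr C \<rightarrow>\<^sub>E Arr C \<and>
     (\<forall>U V. \<forall>f \<in> homs C U V. snd K f \<in> homs C (fst K U) (fst K V)) \<and>
     (\<forall>U \<in> Ob C. snd K (Ide C U) = Ide C (fst K U)) \<and>
     (\<forall>U V W. \<forall>f \<in> homs C U V. \<forall>g \<in> homs C V W.
        snd K (g \<cdot>\<^bsub>C\<^esub> f) = snd K g \<cdot>\<^bsub>C\<^esub> snd K f) \<and>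
     fst K (Unit C) = Unit C \<and>
     (\<forall>U \<in> Ob C. \<forall>V \<in> Ob C. fst K (U \<boxtimes>\<^bsub>C\<^esub> V) = fst K U \<boxtimes>\<^bsub>C\<^esub> fst K V) \<and>
     (\<forall>f \<in> Arr C. \<forall>g \<in> Arr C. snd K (f \<star>\<^bsub>C\<^esub> g) = snd K f \<star>\<^bsub>C\<^esub> snd K g)"
  by (cases K) (simp add: strict_tensor_endos_def)

lemma endo_monoid_mult: "K \<otimes>\<^bsub>endo_monoid C\<^esub> L =
    (compose (Ob C) (fst K) (fst L), compose (Arr C) (snd K) (snd L))"
  by (simp add: endo_monoid_def case_prod_unfold)

context strict_tensor_category
begin

lemma strict_tensor_endos_compose:
  assumes K: "K \<in> strict_tensor_endos C" and L: "L \<in> strict_tensor_endos C"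
  shows "K \<otimes>\<^bsub>endo_monoid C\<^esub> L \<in> strict_tensor_endos C"
proof -
  have KO: "fst K U \<in> Ob C" "fst L U \<in> Ob C" if "U \<in> Ob C" for U
    using that K L by (auto simp: strict_tensor_endos_iff)
  have KA: "snd K f \<in> Arr C" "snd L f \<in> Arr C" if "f \<in> Arr C" for f
    using that K L by (auto simp: strict_tensor_endos_iff)
  have Kh: "snd K f \<in> homs C (fst K U) (fst K V)" if "f \<in> homs C U V" for f U V
    using that K by (auto simp: strict_tensor_endos_iff)
  have Lh: "snd L f \<in> homs C (fst L U) (fst L V)" if "f \<in> homs C U V" for f U V
    using that L by (auto simp: strict_tensor_endos_iff)
  have hO: "f \<in> Arr C" "U \<in> Ob C" "V \<in> Ob C" if "f \<in> homs C U V" for f U V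
    using that by (auto simp: homs_def)
  have comp: "snd K (snd L (g \<cdot> f)) = snd K (snd L g) \<cdot> snd K (snd L f)"
    if "f \<in> homs C U V" "g \<in> homs C V W" for f g U V W
  proof -
    have "snd L (g \<cdot> f) = snd L g \<cdot> snd L f"
      using L that unfolding strict_tensor_endos_iff by blast
    moreover have "snd K (snd L g \<cdot> snd L f) = snd K (snd L g) \<cdot> snd K (snd L f)"
      using K Lh[OF that(1)] Lh[OF that(2)] unfolding strict_tensor_endos_iff by blast
    ultimately show ?thesis by simp
  qed
  show ?thesis
    unfolding strict_tensor_endos_iff endo_monoid_mult fst_conv snd_conv
  proof (intro conjI allI ballI)
    show "compose (Ob C) (fst K) (fst L) \<in> Ob C \<rightarrow>\<^sub>E Ob C"
      using KO by (auto simp: compose_def)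
    show "compose (Arr C) (snd K) (snd L) \<in> Arr C \<rightarrow>\<^sub>E Arr C"
      using KA by (auto simp: compose_def)
    show "compose (Arr C) (snd K) (snd L) f \<in>
        homs C (compose (Ob C) (fst K) (fst L) U) (compose (Ob C) (fst K) (fst L) V)"
      if "f \<in> homs C U V" for f U V
      using that hO[OF that] Kh Lh by (simp add: compose_def)
    show "compose (Arr C) (snd K) (snd L) (g \<cdot> f) =
        compose (Arr C) (snd K) (snd L) g \<cdot> compose (Arr C) (snd K) (snd L) f"
      if "f \<in> homs C U V" "g \<in> homs C V W" for f g U V W
      using hO[OF that(1)] hO[OF that(2)] comp[OF that] hO[OF Comp_homs[OF that]]
      by (simp add: compose_def)
  qed (use K L KO KA in \<open>auto simp: compose_def strict_tensor_endos_iff\<close>)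
qed

lemma strict_tensor_endos_id: "\<one>\<^bsub>endo_monoid C\<^esub> \<in> strict_tensor_endos C"
  unfolding strict_tensor_endos_iff by (auto simp: endo_monoid_def homs_def)

text \<open>The unit laws are equalities of functions on whole types, so they rest on both maps of a
  functor being extensional.\<close>

lemma endo_monoid_monoid: "monoid (endo_monoid C)"
proof (rule monoidI)
  show "K \<otimes>\<^bsub>endo_monoid C\<^esub> L \<in> carrier (endo_monoid C)"
    if "K \<in> carrier (endo_monoid C)" "L \<in> carrier (endo_monoid C)" for K L
    using strict_tensor_endos_compose that by (simp add: endo_monoid_def)
  show "\<one>\<^bsub>endo_monoid C\<^esub> \<in> carrier (endo_monoid C)"
    using strict_tensor_endos_id by (simp add: endo_monoid_def)
  fix K assume "K \<in> carrier (endo_monoid C)"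
  then have K: "K \<in> strict_tensor_endos C" by (simp add: endo_monoid_def)
  then have ext: "fst K \<in> extensional (Ob C)" "snd K \<in> extensional (Arr C)"
    and maps: "fst K \<in> Ob C \<rightarrow> Ob C" "snd K \<in> Arr C \<rightarrow> Arr C"
    by (auto simp: strict_tensor_endos_iff PiE_def)
  show "\<one>\<^bsub>endo_monoid C\<^esub> \<otimes>\<^bsub>endo_monoid C\<^esub> K = K"
    using Id_compose[OF maps(1) ext(1)] Id_compose[OF maps(2) ext(2)]
    by (simp add: endo_monoid_def case_prod_unfold)
  show "K \<otimes>\<^bsub>endo_monoid C\<^esub> \<one>\<^bsub>endo_monoid C\<^esub> = K"
    using compose_Id[OF maps(1) ext(1)] compose_Id[OF maps(2) ext(2)]
    by (simp add: endo_monoid_def case_prod_unfold)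
  fix L M assume "L \<in> carrier (endo_monoid C)" "M \<in> carrier (endo_monoid C)"
  then have "fst M \<in> Ob C \<rightarrow> Ob C" "snd M \<in> Arr C \<rightarrow> Arr C"
    by (auto simp: endo_monoid_def strict_tensor_endos_iff PiE_def)
  then show "K \<otimes>\<^bsub>endo_monoid C\<^esub> L \<otimes>\<^bsub>endo_monoid C\<^esub> M = K \<otimes>\<^bsub>endo_monoid C\<^esub> (L \<otimes>\<^bsub>endo_monoid C\<^esub> M)"
    by (simp add: endo_monoid_mult compose_assoc)
qed

lemma aut_group_group: "group (aut_group C)"
  unfolding aut_group_def by (rule monoid.units_group[OF endo_monoid_monoid])

text \<open>Multiplicativity makes the values at \<open>\<beta>\<close> and at its inverse mutually
  inverse, so membership in the units comes without inverting any functor by hand.\<close>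

lemma hom_aut_groupI:
  assumes "group \<pi>"
    and endo: "\<And>\<beta>. \<beta> \<in> carrier \<pi> \<Longrightarrow> K \<beta> \<in> strict_tensor_endos C"
    and mult: "\<And>\<beta> \<gamma>. \<lbrakk>\<beta> \<in> carrier \<pi>; \<gamma> \<in> carrier \<pi>\<rbrakk> \<Longrightarrow>
      K (\<beta> \<otimes>\<^bsub>\<pi>\<^esub> \<gamma>) = K \<beta> \<otimes>\<^bsub>endo_monoid C\<^esub> K \<gamma>"
    and one: "K \<one>\<^bsub>\<pi>\<^esub> = \<one>\<^bsub>endo_monoid C\<^esub>"
  shows "K \<in> hom \<pi> (aut_group C)"
proof -
  interpret \<pi>: group \<pi> by fact
  have "K \<beta> \<in> Units (endo_monoid C)" if \<beta>: "\<beta> \<in> carrier \<pi>" for \<beta>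
  proof -
    have "K (inv\<^bsub>\<pi>\<^esub> \<beta>) \<otimes>\<^bsub>endo_monoid C\<^esub> K \<beta> = \<one>\<^bsub>endo_monoid C\<^esub>"
      "K \<beta> \<otimes>\<^bsub>endo_monoid C\<^esub> K (inv\<^bsub>\<pi>\<^esub> \<beta>) = \<one>\<^bsub>endo_monoid C\<^esub>"
      using \<beta> by (simp_all add: mult[symmetric] one)
    moreover have "K \<beta> \<in> carrier (endo_monoid C)" "K (inv\<^bsub>\<pi>\<^esub> \<beta>) \<in> carrier (endo_monoid C)"
      using \<beta> endo by (simp_all add: endo_monoid_def)
    ultimately show ?thesis unfolding Units_def by blast
  qed
  then show ?thesis
    using mult by (auto simp: hom_def aut_group_def units_of_carrier units_of_mult)
qed

end


section \<open>Conjugation and degree\<close>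

context strict_T_category
begin

interpretation aut: group "aut_group T" by (rule aut_group_group)

interpretation conj_hom: group_hom \<pi> "aut_group T" "conjugation T"
  by unfold_locales (rule conjugation_hom)

lemma conjugation_endo: "\<beta> \<in> carrier \<pi> \<Longrightarrow> conjugation T \<beta> \<in> strict_tensor_endos T"
  using conj_hom.hom_closed[of \<beta>]
  by (auto simp: aut_group_def units_of_carrier Units_def endo_monoid_def)

text \<open>A homomorphism carries inverses to inverses; this turns the inverse functor in the
  definition of \<open>center_conj_ob\<close> into conjugation by a group element.\<close>

lemma inv_conjugation:
  "\<beta> \<in> carrier \<pi> \<Longrightarrow> fst (inv\<^bsub>aut_group T\<^esub> (conjugation T \<beta>)) = conj_ob T (inv\<^bsub>\<pi>\<^esub> \<beta>)"
  by (simp add: conj_ob_def)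

context
  fixes \<beta>
  assumes \<beta>: "\<beta> \<in> carrier \<pi>"
begin

lemma conj_ob_closed [simp]: "U \<in> Ob T \<Longrightarrow> conj_ob T \<beta> U \<in> Ob T"
  and conj_arr_Arr [simp]: "f \<in> Arr T \<Longrightarrow> conj_arr T \<beta> f \<in> Arr T"
  and conj_arr_homs: "f \<in> homs T U V \<Longrightarrow> conj_arr T \<beta> f \<in> homs T (conj_ob T \<beta> U) (conj_ob T \<beta> V)"
  and conj_arr_Ide [simp]: "U \<in> Ob T \<Longrightarrow> conj_arr T \<beta> (Ide T U) = Ide T (conj_ob T \<beta> U)"
  and conj_ob_Unit [simp]: "conj_ob T \<beta> (Unit T) = Unit T"
  and conj_ob_TenO [simp]: "\<lbrakk>U \<in> Ob T; V \<in> Ob T\<rbrakk> \<Longrightarrow>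
    conj_ob T \<beta> (U \<boxtimes> V) = conj_ob T \<beta> U \<boxtimes> conj_ob T \<beta> V"
  and conj_arr_TenA [simp]: "\<lbrakk>f \<in> Arr T; g \<in> Arr T\<rbrakk> \<Longrightarrow>
    conj_arr T \<beta> (f \<star> g) = conj_arr T \<beta> f \<star> conj_arr T \<beta> g"
  using conjugation_endo[OF \<beta>]
  by (auto simp: strict_tensor_endos_iff conj_ob_def conj_arr_def)

lemma Dom_conj_arr [simp]: "f \<in> Arr T \<Longrightarrow> Dom T (conj_arr T \<beta> f) = conj_ob T \<beta> (Dom T f)"
  and Cod_conj_arr [simp]: "f \<in> Arr T \<Longrightarrow> Cod T (conj_arr T \<beta> f) = conj_ob T \<beta> (Cod T f)"
  using conj_arr_homs[of f "Dom T f" "Cod T f"] by (auto simp: homs_def)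

lemma conj_arr_Comp [simp]:
  assumes "f \<in> Arr T" "g \<in> Arr T" "Dom T g = Cod T f"
  shows "conj_arr T \<beta> (g \<cdot> f) = conj_arr T \<beta> g \<cdot> conj_arr T \<beta> f"
proof -
  have "f \<in> homs T (Dom T f) (Cod T f)" "g \<in> homs T (Cod T f) (Cod T g)"
    using assms by (auto simp: homs_def)
  then show ?thesis
    using conjugation_endo[OF \<beta>] unfolding strict_tensor_endos_iff conj_arr_def by blast
qed

lemma is_iso_conj_arr:
  assumes "is_iso T f"
  shows "is_iso T (conj_arr T \<beta> f)"
proof -
  have f: "f \<in> homs T (Dom T f) (Cod T f)" using assms by (auto simp: is_iso_def homs_def)
  obtain g where g: "g \<in> homs T (Cod T f) (Dom T f)" "g \<cdot> f = Ide T (Dom T f)"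
      "f \<cdot> g = Ide T (Cod T f)"
    using is_isoE[OF assms f] .
  show ?thesis
    by (rule is_isoI[OF conj_arr_homs[OF f] conj_arr_homs[OF g(1)]])
      (use f g in \<open>auto simp: homs_def simp flip: conj_arr_Comp conj_arr_Ide\<close>)
qed

end

context
  fixes \<beta> \<gamma>
  assumes \<beta>: "\<beta> \<in> carrier \<pi>" and \<gamma>: "\<gamma> \<in> carrier \<pi>"
begin

lemma conj_ob_mult [simp]:
    "U \<in> Ob T \<Longrightarrow> conj_ob T (\<beta> \<otimes>\<^bsub>\<pi>\<^esub> \<gamma>) U = conj_ob T \<beta> (conj_ob T \<gamma> U)"
  and conj_arr_mult [simp]:
    "f \<in> Arr T \<Longrightarrow> conj_arr T (\<beta> \<otimes>\<^bsub>\<pi>\<^esub> \<gamma>) f = conj_arr T \<beta> (conj_arr T \<gamma> f)"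
  using conj_hom.hom_mult[OF \<beta> \<gamma>]
  by (simp_all add: aut_group_def units_of_mult endo_monoid_mult conj_ob_def conj_arr_def compose_def)

end

lemma conj_ob_one [simp]: "U \<in> Ob T \<Longrightarrow> conj_ob T \<one>\<^bsub>\<pi>\<^esub> U = U"
  and conj_arr_one [simp]: "f \<in> Arr T \<Longrightarrow> conj_arr T \<one>\<^bsub>\<pi>\<^esub> f = f"
  using conj_hom.hom_one
  by (simp_all add: aut_group_def units_of_one endo_monoid_def conj_ob_def conj_arr_def)

lemma conj_ob_inv [simp]:
  assumes "\<beta> \<in> carrier \<pi>" "U \<in> Ob T"
  shows "conj_ob T (inv\<^bsub>\<pi>\<^esub> \<beta>) (conj_ob T \<beta> U) = U" "conj_ob T \<beta> (conj_ob T (inv\<^bsub>\<pi>\<^esub> \<beta>) U) = U"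
  using assms by (simp_all flip: conj_ob_mult)

lemma conj_arr_inv [simp]:
  assumes "\<beta> \<in> carrier \<pi>" "f \<in> Arr T"
  shows "conj_arr T (inv\<^bsub>\<pi>\<^esub> \<beta>) (conj_arr T \<beta> f) = f" "conj_arr T \<beta> (conj_arr T (inv\<^bsub>\<pi>\<^esub> \<beta>) f) = f"
  using assms by (simp_all flip: conj_arr_mult)

text \<open>Disjointness of the components is what makes the description in \<open>degree\<close>
  unique.\<close>

lemma degree_eqI:
  assumes "\<alpha> \<in> carrier \<pi>" "U \<in> component T \<alpha>"
  shows "degree \<pi> T U = \<alpha>"
  unfolding degree_def
  by (rule the_equality)
    (use assms component_disjoint in \<open>auto simp: disjoint_family_on_def\<close>)

lemma component_Ob: "\<lbrakk>\<alpha> \<in> carrier \<pi>; U \<in> component T \<alpha>\<rbrakk> \<Longrightarrow> U \<in> Ob T"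
  using component_Union by blast

lemma
  assumes "U \<in> Ob T"
  shows degree_closed [simp]: "degree \<pi> T U \<in> carrier \<pi>"
    and degree_component: "U \<in> component T (degree \<pi> T U)"
  using assms component_Union degree_eqI by auto

lemma degree_TenO [simp]:
  "\<lbrakk>U \<in> Ob T; V \<in> Ob T\<rbrakk> \<Longrightarrow> degree \<pi> T (U \<boxtimes> V) = degree \<pi> T U \<otimes>\<^bsub>\<pi>\<^esub> degree \<pi> T V"
  by (intro degree_eqI component_TenO) (auto intro: degree_component)

text \<open>The unit object is its own tensor square, so its degree is an idempotent of a
  group.\<close>

lemma degree_Unit [simp]: "degree \<pi> T (Unit T) = \<one>\<^bsub>\<pi>\<^esub>"
  using degree_TenO[of "Unit T" "Unit T"] l_cancel_one'[of "degree \<pi> T (Unit T)" "degree \<pi> T (Unit T)"]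
  by simp

lemma degree_conj [simp]:
  assumes "\<beta> \<in> carrier \<pi>" "U \<in> Ob T"
  shows "degree \<pi> T (conj_ob T \<beta> U) = \<beta> \<otimes>\<^bsub>\<pi>\<^esub> degree \<pi> T U \<otimes>\<^bsub>\<pi>\<^esub> inv\<^bsub>\<pi>\<^esub> \<beta>"
  using assms conj_ob_component[of "degree \<pi> T U" \<beta>] degree_component[of U]
  by (intro degree_eqI) auto

text \<open>No arrows run between different components, so both ends of \<open>f\<close> lie in the
  same one.\<close>

lemma degree_Cod [simp]:
  assumes "f \<in> Arr T"
  shows "degree \<pi> T (Cod T f) = degree \<pi> T (Dom T f)"
proof -
  obtain \<alpha> where "\<alpha> \<in> carrier \<pi>" "f \<in> component_arr T \<alpha>"
    using component_arr_Union assms by blast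
  then show ?thesis by (simp add: component_arr_def degree_eqI)
qed

end

section \<open>Half-braidings\<close>

context strict_T_category
begin

text \<open>Naturality takes its endpoints through equations, so that it applies where
  \<open>Dom T g\<close> and \<open>Cod T g\<close> match only after simplification.\<close>

lemma
  assumes "half_braiding \<pi> T U c"
  shows half_braiding_Ob: "U \<in> Ob T"
    and half_braiding_extensional: "c \<in> extensional (Ob T)"
    and half_braiding_Arr: "X \<in> Ob T \<Longrightarrow> c X \<in> Arr T"
    and half_braiding_Dom: "X \<in> Ob T \<Longrightarrow> Dom T (c X) = U \<boxtimes> X"
    and half_braiding_Cod: "X \<in> Ob T \<Longrightarrow> Cod T (c X) = conj_ob T (degree \<pi> T U) X \<boxtimes> U"
    and half_braiding_is_iso: "X \<in> Ob T \<Longrightarrow> is_iso T (c X)"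
    and half_braiding_natural: "\<lbrakk>g \<in> Arr T; Dom T g = X; Cod T g = Y\<rbrakk> \<Longrightarrow>
      (conj_arr T (degree \<pi> T U) g \<star> Ide T U) \<cdot> c X = c Y \<cdot> (Ide T U \<star> g)"
    and half_braiding_TenO: "\<lbrakk>X \<in> Ob T; Y \<in> Ob T\<rbrakk> \<Longrightarrow>
      c (X \<boxtimes> Y) = (Ide T (conj_ob T (degree \<pi> T U) X) \<star> c Y) \<cdot> (c X \<star> Ide T Y)"
  using assms unfolding half_braiding_def act_ob_def act_arr_def homs_def by auto

lemmas half_braiding_simps =
  half_braiding_Ob half_braiding_Arr half_braiding_Dom half_braiding_Cod

lemma half_braidingI:
  assumes "U \<in> Ob T" "c \<in> extensional (Ob T)"
    and "\<And>X. X \<in> Ob T \<Longrightarrow> is_iso T (c X)"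
    and "\<And>X. X \<in> Ob T \<Longrightarrow> Dom T (c X) = U \<boxtimes> X"
    and "\<And>X. X \<in> Ob T \<Longrightarrow> Cod T (c X) = conj_ob T (degree \<pi> T U) X \<boxtimes> U"
    and "\<And>g. g \<in> Arr T \<Longrightarrow>
      (conj_arr T (degree \<pi> T U) g \<star> Ide T U) \<cdot> c (Dom T g) = c (Cod T g) \<cdot> (Ide T U \<star> g)"
    and "\<And>X Y. \<lbrakk>X \<in> Ob T; Y \<in> Ob T\<rbrakk> \<Longrightarrow>
      c (X \<boxtimes> Y) = (Ide T (conj_ob T (degree \<pi> T U) X) \<star> c Y) \<cdot> (c X \<star> Ide T Y)"
  shows "half_braiding \<pi> T U c"
  using assms unfolding half_braiding_def act_ob_def act_arr_def homs_def
  by (auto simp: is_iso_def)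

lemma half_braiding_Unit: "half_braiding \<pi> T (Unit T) (\<lambda>X \<in> Ob T. Ide T X)"
  by (rule half_braidingI) (auto simp: is_iso_Ide TenA_Ide)

lemma half_braiding_center_TenO:
  assumes c: "half_braiding \<pi> T U c" and d: "half_braiding \<pi> T V d"
  shows "half_braiding \<pi> T (U \<boxtimes> V)
    (\<lambda>X \<in> Ob T. (c (conj_ob T (degree \<pi> T V) X) \<star> Ide T V) \<cdot> (Ide T U \<star> d X))"
    (is "half_braiding \<pi> T _ ?e")
proof (rule half_braidingI)
  let ?u = "degree \<pi> T U" and ?v = "degree \<pi> T V"
  note [simp] = half_braiding_simps[OF c] half_braiding_simps[OF d] TenO_assoc
  \<comment> \<open>These rules split identities of tensor products and distribute whiskering over
    composition, giving composites of the same elementary arrows one right-nested form.\<close>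
  note norm = Comp_assoc_Arr TenA_assoc whisker_left whisker_right TenA_Ide[symmetric]
  show "is_iso T (?e X)" if "X \<in> Ob T" for X
    using that by (simp add: is_iso_Comp is_iso_TenA is_iso_Ide half_braiding_is_iso[OF c]
        half_braiding_is_iso[OF d])
  show "(conj_arr T (degree \<pi> T (U \<boxtimes> V)) g \<star> Ide T (U \<boxtimes> V)) \<cdot> ?e (Dom T g) =
      ?e (Cod T g) \<cdot> (Ide T (U \<boxtimes> V) \<star> g)" if g: "g \<in> Arr T" for g
  proof -
    let ?X = "Dom T g" and ?Y = "Cod T g"
    have "(conj_arr T ?u (conj_arr T ?v g) \<star> Ide T (U \<boxtimes> V)) \<cdot>
          ((c (conj_ob T ?v ?X) \<star> Ide T V) \<cdot> (Ide T U \<star> d ?X)) =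
        (((conj_arr T ?u (conj_arr T ?v g) \<star> Ide T U) \<cdot> c (conj_ob T ?v ?X)) \<star> Ide T V) \<cdot>
          (Ide T U \<star> d ?X)"
      using g by (simp add: norm)
    \<comment> \<open>Naturality of \<open>c\<close> is taken at the conjugated arrow
      \<open>conj_arr T ?v g\<close>, whose endpoints are the objects at which \<open>c\<close>
      occurs in the composites.\<close>
    also have "(conj_arr T ?u (conj_arr T ?v g) \<star> Ide T U) \<cdot> c (conj_ob T ?v ?X) =
        c (conj_ob T ?v ?Y) \<cdot> (Ide T U \<star> conj_arr T ?v g)"
      using g by (intro half_braiding_natural[OF c]) simp_all
    also have "((c (conj_ob T ?v ?Y) \<cdot> (Ide T U \<star> conj_arr T ?v g)) \<star> Ide T V) \<cdot> (Ide T U \<star> d ?X) =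
        (c (conj_ob T ?v ?Y) \<star> Ide T V) \<cdot> (Ide T U \<star> ((conj_arr T ?v g \<star> Ide T V) \<cdot> d ?X))"
      using g by (simp add: norm)
    also have "(conj_arr T ?v g \<star> Ide T V) \<cdot> d ?X = d ?Y \<cdot> (Ide T V \<star> g)"
      using g by (intro half_braiding_natural[OF d]) simp_all
    also have "(c (conj_ob T ?v ?Y) \<star> Ide T V) \<cdot> (Ide T U \<star> (d ?Y \<cdot> (Ide T V \<star> g))) =
        ((c (conj_ob T ?v ?Y) \<star> Ide T V) \<cdot> (Ide T U \<star> d ?Y)) \<cdot> (Ide T (U \<boxtimes> V) \<star> g)"
      using g by (simp add: norm)
    finally show ?thesis using g by simp
  qed
  show "?e (X \<boxtimes> Y) =
      (Ide T (conj_ob T (degree \<pi> T (U \<boxtimes> V)) X) \<star> ?e Y) \<cdot> (?e X \<star> Ide T Y)"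
    if X: "X \<in> Ob T" and Y: "Y \<in> Ob T" for X Y
  proof -
    let ?vX = "conj_ob T ?v X" and ?vY = "conj_ob T ?v Y"
    let ?uvX = "conj_ob T ?u ?vX"
    \<comment> \<open>Both sides equal \<open>c ?vX \<star> d Y\<close>; the two outer factors of
      the expanded hexagon agree on both sides.\<close>
    have "(c ?vX \<star> Ide T (?vY \<boxtimes> V)) \<cdot> (Ide T (U \<boxtimes> ?vX) \<star> d Y) =
        (Ide T (?uvX \<boxtimes> U) \<star> d Y) \<cdot> (c ?vX \<star> Ide T (V \<boxtimes> Y))"
      using X Y by (simp add: interchange_left_first interchange_right_first)
    then have "(c ?vX \<star> Ide T (?vY \<boxtimes> V)) \<cdot> ((Ide T (U \<boxtimes> ?vX) \<star> d Y) \<cdot> (Ide T U \<star> (d X \<star> Ide T Y))) =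
        (Ide T (?uvX \<boxtimes> U) \<star> d Y) \<cdot> ((c ?vX \<star> Ide T (V \<boxtimes> Y)) \<cdot> (Ide T U \<star> (d X \<star> Ide T Y)))"
      by (rule Comp_eq_extend) (use X Y in simp_all)
    then show ?thesis
      using X Y by (simp add: half_braiding_TenO[OF c] half_braiding_TenO[OF d] norm)
  qed
qed (simp_all add: half_braiding_simps[OF c] half_braiding_simps[OF d] TenO_assoc)

section \<open>Conjugates of half-braidings\<close>

lemma center_conj_ob_eq:
  "\<beta> \<in> carrier \<pi> \<Longrightarrow> center_conj_ob T \<beta> (U, c) =
    (conj_ob T \<beta> U, \<lambda>X \<in> Ob T. conj_arr T \<beta> (c (conj_ob T (inv\<^bsub>\<pi>\<^esub> \<beta>) X)))"
  by (simp add: center_conj_ob_def inv_conjugation)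

text \<open>Each law is the image under conjugation by \<open>\<beta>\<close> of the law for
  \<open>c\<close> at arguments moved back by the inverse of \<open>\<beta>\<close>; the degree of
  the conjugated object contains the factor that performs this move.\<close>

lemma half_braiding_center_conj:
  assumes c: "half_braiding \<pi> T U c" and \<beta>: "\<beta> \<in> carrier \<pi>"
  shows "half_braiding \<pi> T (conj_ob T \<beta> U)
    (\<lambda>X \<in> Ob T. conj_arr T \<beta> (c (conj_ob T (inv\<^bsub>\<pi>\<^esub> \<beta>) X)))"
    (is "half_braiding \<pi> T _ ?e")
proof (rule half_braidingI)
  let ?u = "degree \<pi> T U"
  note [simp] = half_braiding_simps[OF c] \<beta>
  show "is_iso T (?e X)" if "X \<in> Ob T" for X
    using that by (simp add: is_iso_conj_arr half_braiding_is_iso[OF c])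
  show "(conj_arr T (degree \<pi> T (conj_ob T \<beta> U)) g \<star> Ide T (conj_ob T \<beta> U)) \<cdot> ?e (Dom T g) =
      ?e (Cod T g) \<cdot> (Ide T (conj_ob T \<beta> U) \<star> g)" if g: "g \<in> Arr T" for g
  proof -
    \<comment> \<open>Conjugating the naturality square of \<open>c\<close> at \<open>?h\<close>
      returns a square over \<open>g\<close>.\<close>
    let ?h = "conj_arr T (inv\<^bsub>\<pi>\<^esub> \<beta>) g"
    have "(conj_arr T ?u ?h \<star> Ide T U) \<cdot> c (Dom T ?h) = c (Cod T ?h) \<cdot> (Ide T U \<star> ?h)"
      using g by (intro half_braiding_natural[OF c]) simp_all
    then have "conj_arr T \<beta> ((conj_arr T ?u ?h \<star> Ide T U) \<cdot> c (Dom T ?h)) =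
        conj_arr T \<beta> (c (Cod T ?h) \<cdot> (Ide T U \<star> ?h))"
      by simp
    then show ?thesis using g by simp
  qed
qed (use c \<beta> in \<open>simp_all add: half_braiding_simps half_braiding_TenO TenO_assoc\<close>)


section \<open>Arrows of the center\<close>

lemma center_Arr_iff:
  "((U, c), f, (V, d)) \<in> center_Arr \<pi> T \<longleftrightarrow>
     half_braiding \<pi> T U c \<and> half_braiding \<pi> T V d \<and> f \<in> Arr T \<and> Dom T f = U \<and> Cod T f = V \<and>
     (\<forall>X \<in> Ob T. (Ide T (conj_ob T (degree \<pi> T U) X) \<star> f) \<cdot> c X = d X \<cdot> (f \<star> Ide T X))"
  by (auto simp: center_Arr_def act_ob_def homs_def)

lemma center_Arr_Ide:
  assumes "half_braiding \<pi> T U c"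
  shows "((U, c), Ide T U, (U, c)) \<in> center_Arr \<pi> T"
  using assms by (simp add: center_Arr_iff half_braiding_simps TenA_Ide)

text \<open>The underlying arrow stays inside one component; hence \<open>\<^sup>UX\<close> and
  \<open>\<^sup>VX\<close> may be exchanged in all arrow conditions.\<close>

lemma center_Arr_degree:
  assumes "((U, c), f, (V, d)) \<in> center_Arr \<pi> T"
  shows "degree \<pi> T V = degree \<pi> T U"
  using assms degree_Cod[of f] by (auto simp: center_Arr_iff)

lemma center_Arr_Comp:
  assumes f: "((U, c), f, (V, d)) \<in> center_Arr \<pi> T" and g: "((V, d), g, (W, e)) \<in> center_Arr \<pi> T"
  shows "((U, c), g \<cdot> f, (W, e)) \<in> center_Arr \<pi> T"
proof -
  \<comment> \<open>The condition on \<open>g\<close> is stated with the action of \<open>V\<close>;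
    equality of degrees rewrites it to that of \<open>U\<close>.\<close>
  note hyps = f[unfolded center_Arr_iff] g[unfolded center_Arr_iff center_Arr_degree[OF f]]
  have c: "half_braiding \<pi> T U c" and d: "half_braiding \<pi> T V d" and e: "half_braiding \<pi> T W e"
    using hyps by auto
  have [simp]: "f \<in> Arr T" "Dom T f = U" "Cod T f = V" "g \<in> Arr T" "Dom T g = V" "Cod T g = W"
    using hyps by auto
  note [simp] = half_braiding_simps[OF c] half_braiding_simps[OF d] half_braiding_simps[OF e]
    center_Arr_degree[OF f] center_Arr_degree[OF g]
  have "(Ide T (conj_ob T (degree \<pi> T U) X) \<star> (g \<cdot> f)) \<cdot> c X = e X \<cdot> ((g \<cdot> f) \<star> Ide T X)"
    if X: "X \<in> Ob T" for X
  proof -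
    let ?uX = "conj_ob T (degree \<pi> T U) X"
    have "(Ide T ?uX \<star> (g \<cdot> f)) \<cdot> c X = (Ide T ?uX \<star> g) \<cdot> ((Ide T ?uX \<star> f) \<cdot> c X)"
      using X by (simp add: whisker_left Comp_assoc_Arr)
    also have "(Ide T ?uX \<star> f) \<cdot> c X = d X \<cdot> (f \<star> Ide T X)"
      using hyps X by auto
    also have "(Ide T ?uX \<star> g) \<cdot> (d X \<cdot> (f \<star> Ide T X)) = ((Ide T ?uX \<star> g) \<cdot> d X) \<cdot> (f \<star> Ide T X)"
      using X by (simp add: Comp_assoc_Arr)
    also have "(Ide T ?uX \<star> g) \<cdot> d X = e X \<cdot> (g \<star> Ide T X)"
      using hyps X by auto
    also have "(e X \<cdot> (g \<star> Ide T X)) \<cdot> (f \<star> Ide T X) = e X \<cdot> ((g \<cdot> f) \<star> Ide T X)"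
      using X by (simp add: whisker_right Comp_assoc_Arr)
    finally show ?thesis .
  qed
  then show ?thesis using c e by (simp add: center_Arr_iff)
qed

lemma center_TenO_eq:
  "center_TenO \<pi> T (U, c) (V, d) =
    (U \<boxtimes> V, \<lambda>X \<in> Ob T. (c (conj_ob T (degree \<pi> T V) X) \<star> Ide T V) \<cdot> (Ide T U \<star> d X))"
  by (simp add: center_TenO_def act_ob_def)

text \<open>Functoriality of the tensor product is proved one variable at a time. Here
  \<open>f\<close> passes \<open>c\<close> by its own arrow condition, taken at
  \<open>\<^sup>WX\<close>, and then passes \<open>e\<close> by interchange.\<close>

lemma center_Arr_whisker_right:
  assumes f: "((U, c), f, (V, d)) \<in> center_Arr \<pi> T" and e: "half_braiding \<pi> T W e"
  shows "(center_TenO \<pi> T (U, c) (W, e), f \<star> Ide T W, center_TenO \<pi> T (V, d) (W, e)) \<in> center_Arr \<pi> T"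
proof -
  note hyps = f[unfolded center_Arr_iff]
  have c: "half_braiding \<pi> T U c" and d: "half_braiding \<pi> T V d"
    using hyps by auto
  have [simp]: "f \<in> Arr T" "Dom T f = U" "Cod T f = V"
    using hyps by auto
  note [simp] = half_braiding_simps[OF c] half_braiding_simps[OF d] half_braiding_simps[OF e]
    center_Arr_degree[OF f] TenO_assoc
  note norm = Comp_assoc_Arr TenA_assoc whisker_left whisker_right TenA_Ide[symmetric]
  let ?u = "degree \<pi> T U" and ?w = "degree \<pi> T W"
  have "(Ide T (conj_ob T ?u (conj_ob T ?w X)) \<star> (f \<star> Ide T W)) \<cdot>
        ((c (conj_ob T ?w X) \<star> Ide T W) \<cdot> (Ide T U \<star> e X)) =
      ((d (conj_ob T ?w X) \<star> Ide T W) \<cdot> (Ide T V \<star> e X)) \<cdot> ((f \<star> Ide T W) \<star> Ide T X)"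
    if X: "X \<in> Ob T" for X
  proof -
    let ?wX = "conj_ob T ?w X"
    have "(Ide T (conj_ob T ?u ?wX) \<star> (f \<star> Ide T W)) \<cdot> ((c ?wX \<star> Ide T W) \<cdot> (Ide T U \<star> e X)) =
        (((Ide T (conj_ob T ?u ?wX) \<star> f) \<cdot> c ?wX) \<star> Ide T W) \<cdot> (Ide T U \<star> e X)"
      using X by (simp add: norm)
    also have "(Ide T (conj_ob T ?u ?wX) \<star> f) \<cdot> c ?wX = d ?wX \<cdot> (f \<star> Ide T ?wX)"
      using hyps X by auto
    also have "((d ?wX \<cdot> (f \<star> Ide T ?wX)) \<star> Ide T W) \<cdot> (Ide T U \<star> e X) =
        (d ?wX \<star> Ide T W) \<cdot> ((f \<star> Ide T (?wX \<boxtimes> W)) \<cdot> (Ide T U \<star> e X))"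
      using X by (simp add: norm)
    also have "(f \<star> Ide T (?wX \<boxtimes> W)) \<cdot> (Ide T U \<star> e X) = (Ide T V \<star> e X) \<cdot> (f \<star> Ide T (W \<boxtimes> X))"
      using X by (simp add: interchange_left_first interchange_right_first)
    also have "(d ?wX \<star> Ide T W) \<cdot> ((Ide T V \<star> e X) \<cdot> (f \<star> Ide T (W \<boxtimes> X))) =
        ((d ?wX \<star> Ide T W) \<cdot> (Ide T V \<star> e X)) \<cdot> ((f \<star> Ide T W) \<star> Ide T X)"
      using X by (simp add: norm)
    finally show ?thesis .
  qed
  then show ?thesis
    using half_braiding_center_TenO[OF c e] half_braiding_center_TenO[OF d e]
    by (simp add: center_Arr_iff center_TenO_eq)
qed

text \<open>The order is reversed: \<open>f\<close> passes \<open>e\<close> by interchange and then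
  \<open>c\<close> by its arrow condition at \<open>X\<close>. Equality of the degrees of
  \<open>U\<close> and \<open>V\<close> puts \<open>e\<close> at the same object on both
  sides.\<close>

lemma center_Arr_whisker_left:
  assumes f: "((U, c), f, (V, d)) \<in> center_Arr \<pi> T" and e: "half_braiding \<pi> T W e"
  shows "(center_TenO \<pi> T (W, e) (U, c), Ide T W \<star> f, center_TenO \<pi> T (W, e) (V, d)) \<in> center_Arr \<pi> T"
proof -
  note hyps = f[unfolded center_Arr_iff]
  have c: "half_braiding \<pi> T U c" and d: "half_braiding \<pi> T V d"
    using hyps by auto
  have [simp]: "f \<in> Arr T" "Dom T f = U" "Cod T f = V"
    using hyps by auto
  note [simp] = half_braiding_simps[OF c] half_braiding_simps[OF d] half_braiding_simps[OF e]
    center_Arr_degree[OF f] TenO_assoc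
  note norm = Comp_assoc_Arr TenA_assoc whisker_left whisker_right TenA_Ide[symmetric]
  let ?u = "degree \<pi> T U" and ?w = "degree \<pi> T W"
  have "(Ide T (conj_ob T ?w (conj_ob T ?u X)) \<star> (Ide T W \<star> f)) \<cdot>
        ((e (conj_ob T ?u X) \<star> Ide T U) \<cdot> (Ide T W \<star> c X)) =
      ((e (conj_ob T ?u X) \<star> Ide T V) \<cdot> (Ide T W \<star> d X)) \<cdot> ((Ide T W \<star> f) \<star> Ide T X)"
    if X: "X \<in> Ob T" for X
  proof -
    let ?uX = "conj_ob T ?u X"
    have "(Ide T (conj_ob T ?w ?uX \<boxtimes> W) \<star> f) \<cdot> (e ?uX \<star> Ide T U) =
        (e ?uX \<star> Ide T V) \<cdot> (Ide T (W \<boxtimes> ?uX) \<star> f)"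
      using X by (simp add: interchange_left_first interchange_right_first)
    then have "(Ide T (conj_ob T ?w ?uX \<boxtimes> W) \<star> f) \<cdot> ((e ?uX \<star> Ide T U) \<cdot> (Ide T W \<star> c X)) =
        (e ?uX \<star> Ide T V) \<cdot> ((Ide T (W \<boxtimes> ?uX) \<star> f) \<cdot> (Ide T W \<star> c X))"
      by (rule Comp_eq_extend) (use X in simp_all)
    also have "(Ide T (W \<boxtimes> ?uX) \<star> f) \<cdot> (Ide T W \<star> c X) =
        Ide T W \<star> ((Ide T ?uX \<star> f) \<cdot> c X)"
      using X by (simp add: norm)
    also have "(Ide T ?uX \<star> f) \<cdot> c X = d X \<cdot> (f \<star> Ide T X)"
      using hyps X by auto
    finally show ?thesis
      using X by (simp add: norm)
  qed
  then show ?thesis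
    using half_braiding_center_TenO[OF e c] half_braiding_center_TenO[OF e d]
    by (simp add: center_Arr_iff center_TenO_eq)
qed

lemma center_Arr_TenA:
  assumes f: "((U, c), f, (V, d)) \<in> center_Arr \<pi> T" and f': "((U', c'), f', (V', d')) \<in> center_Arr \<pi> T"
  shows "(center_TenO \<pi> T (U, c) (U', c'), f \<star> f', center_TenO \<pi> T (V, d) (V', d')) \<in> center_Arr \<pi> T"
proof -
  have "half_braiding \<pi> T U' c'" "half_braiding \<pi> T V d"
    using f f' by (auto simp: center_Arr_iff)
  \<comment> \<open>The arrow \<open>f \<star> f'\<close> is factored through
    \<open>V \<boxtimes> U'\<close>, with \<open>f\<close> applied first.\<close>
  from center_Arr_Comp[OF center_Arr_whisker_right[OF f this(1), unfolded center_TenO_eq]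
      center_Arr_whisker_left[OF f' this(2), unfolded center_TenO_eq]]
  show ?thesis
    using f f' by (simp add: interchange_left_first center_TenO_eq center_Arr_iff)
qed

lemma center_Arr_conj:
  assumes f: "((U, c), f, (V, d)) \<in> center_Arr \<pi> T" and \<beta>: "\<beta> \<in> carrier \<pi>"
  shows "(center_conj_ob T \<beta> (U, c), conj_arr T \<beta> f, center_conj_ob T \<beta> (V, d)) \<in> center_Arr \<pi> T"
proof -
  note hyps = f[unfolded center_Arr_iff]
  have c: "half_braiding \<pi> T U c" and d: "half_braiding \<pi> T V d"
    using hyps by auto
  have [simp]: "f \<in> Arr T" "Dom T f = U" "Cod T f = V"
    using hyps by auto
  note [simp] = half_braiding_simps[OF c] half_braiding_simps[OF d] center_Arr_degree[OF f] \<beta>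
  have "(Ide T (conj_ob T (degree \<pi> T (conj_ob T \<beta> U)) X) \<star> conj_arr T \<beta> f) \<cdot>
        conj_arr T \<beta> (c (conj_ob T (inv\<^bsub>\<pi>\<^esub> \<beta>) X)) =
      conj_arr T \<beta> (d (conj_ob T (inv\<^bsub>\<pi>\<^esub> \<beta>) X)) \<cdot> (conj_arr T \<beta> f \<star> Ide T X)"
    if X: "X \<in> Ob T" for X
  proof -
    \<comment> \<open>Since \<open>X\<close> is the conjugate of \<open>?Y\<close> by
      \<open>\<beta>\<close>, conjugating the arrow condition at \<open>?Y\<close> gives the one at
      \<open>X\<close>.\<close>
    let ?Y = "conj_ob T (inv\<^bsub>\<pi>\<^esub> \<beta>) X"
    have "(Ide T (conj_ob T (degree \<pi> T U) ?Y) \<star> f) \<cdot> c ?Y = d ?Y \<cdot> (f \<star> Ide T ?Y)"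
      using hyps X by simp
    then have "conj_arr T \<beta> ((Ide T (conj_ob T (degree \<pi> T U) ?Y) \<star> f) \<cdot> c ?Y) =
        conj_arr T \<beta> (d ?Y \<cdot> (f \<star> Ide T ?Y))"
      by simp
    then show ?thesis using X by simp
  qed
  then show ?thesis
    using half_braiding_center_conj[OF c \<beta>] half_braiding_center_conj[OF d \<beta>]
    by (simp add: center_Arr_iff center_conj_ob_eq)
qed

text \<open>Composing the condition for \<open>f\<close> with the inverse on both sides gives the
  condition for \<open>g\<close>. Thus the forgetful functor to \<open>T\<close> reflects
  isomorphisms, and the braiding need only be inverted in \<open>T\<close>.\<close>

lemma center_Arr_inverse:
  assumes f: "((U, c), f, (V, d)) \<in> center_Arr \<pi> T"
    and g: "g \<in> homs T V U" "g \<cdot> f = Ide T U" "f \<cdot> g = Ide T V"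
  shows "((V, d), g, (U, c)) \<in> center_Arr \<pi> T"
proof -
  note hyps = f[unfolded center_Arr_iff]
  have c: "half_braiding \<pi> T U c" and d: "half_braiding \<pi> T V d"
    using hyps by auto
  have [simp]: "f \<in> Arr T" "Dom T f = U" "Cod T f = V" "g \<in> Arr T" "Dom T g = V" "Cod T g = U"
    using hyps g by (auto simp: homs_def)
  note [simp] = half_braiding_simps[OF c] half_braiding_simps[OF d] center_Arr_degree[OF f]
  have "(Ide T (conj_ob T (degree \<pi> T U) X) \<star> g) \<cdot> d X = c X \<cdot> (g \<star> Ide T X)"
    if X: "X \<in> Ob T" for X
  proof -
    let ?uX = "conj_ob T (degree \<pi> T U) X"
    \<comment> \<open>The identity \<open>f \<cdot> g\<close> is inserted on the right to make the
      condition for \<open>f\<close> applicable; \<open>g\<close> then cancels \<open>f\<close> on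
      the left.\<close>
    have "(Ide T ?uX \<star> g) \<cdot> d X = ((Ide T ?uX \<star> g) \<cdot> d X) \<cdot> ((f \<cdot> g) \<star> Ide T X)"
      using X by (simp add: g TenA_Ide)
    also have "\<dots> = (Ide T ?uX \<star> g) \<cdot> ((d X \<cdot> (f \<star> Ide T X)) \<cdot> (g \<star> Ide T X))"
      using X by (simp add: whisker_right Comp_assoc_Arr)
    also have "d X \<cdot> (f \<star> Ide T X) = (Ide T ?uX \<star> f) \<cdot> c X"
      using hyps X by simp
    also have "(Ide T ?uX \<star> g) \<cdot> (((Ide T ?uX \<star> f) \<cdot> c X) \<cdot> (g \<star> Ide T X)) =
        ((Ide T ?uX \<star> (g \<cdot> f)) \<cdot> c X) \<cdot> (g \<star> Ide T X)"
      using X by (simp add: whisker_left Comp_assoc_Arr)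
    also have "\<dots> = c X \<cdot> (g \<star> Ide T X)"
      using X by (simp add: g TenA_Ide)
    finally show ?thesis .
  qed
  then show ?thesis using c d by (simp add: center_Arr_iff)
qed

text \<open>
  The condition at \<open>X\<close> is the naturality of \<open>c\<close> with respect to the component \<open>d X\<close>, read through
  the hexagon for \<open>c\<close> at \<open>V \<otimes> X\<close> and at \<open>\<^sup>VX \<otimes> V\<close>.
\<close>

lemma center_Arr_half_braiding:
  assumes c: "half_braiding \<pi> T U c" and d: "half_braiding \<pi> T V d"
  shows "(center_TenO \<pi> T (U, c) (V, d), c V,
    center_TenO \<pi> T (center_conj_ob T (degree \<pi> T U) (V, d)) (U, c)) \<in> center_Arr \<pi> T"
proof -
  let ?u = "degree \<pi> T U" and ?v = "degree \<pi> T V"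
  note [simp] = half_braiding_simps[OF c] half_braiding_simps[OF d] TenO_assoc
  note norm = Comp_assoc_Arr TenA_assoc whisker_left whisker_right TenA_Ide[symmetric]
  have "(Ide T (conj_ob T ?u (conj_ob T ?v X)) \<star> c V) \<cdot>
        ((c (conj_ob T ?v X) \<star> Ide T V) \<cdot> (Ide T U \<star> d X)) =
      ((conj_arr T ?u (d X) \<star> Ide T U) \<cdot> (Ide T (conj_ob T ?u V) \<star> c X)) \<cdot> (c V \<star> Ide T X)"
    if X: "X \<in> Ob T" for X
  proof -
    let ?vX = "conj_ob T ?v X"
    have "(Ide T (conj_ob T ?u ?vX) \<star> c V) \<cdot> ((c ?vX \<star> Ide T V) \<cdot> (Ide T U \<star> d X)) =
        c (?vX \<boxtimes> V) \<cdot> (Ide T U \<star> d X)"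
      using X by (simp add: half_braiding_TenO[OF c] Comp_assoc_Arr)
    also have "\<dots> = (conj_arr T ?u (d X) \<star> Ide T U) \<cdot> c (V \<boxtimes> X)"
      using X by (intro half_braiding_natural[OF c, symmetric]) simp_all
    also have "\<dots> = ((conj_arr T ?u (d X) \<star> Ide T U) \<cdot> (Ide T (conj_ob T ?u V) \<star> c X)) \<cdot> (c V \<star> Ide T X)"
      using X by (simp add: half_braiding_TenO[OF c] Comp_assoc_Arr)
    finally show ?thesis .
  qed
  then show ?thesis
    using half_braiding_center_TenO[OF c d]
      half_braiding_center_TenO[OF half_braiding_center_conj[OF d degree_closed] c]
    by (simp add: center_Arr_iff center_TenO_eq center_conj_ob_eq)
qed


section \<open>The center as a strict T-category\<close>

text \<open>Components are the fibres of the degree, so membership becomes a computation in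
  \<open>\<pi>\<close>.\<close>

lemma component_iff:
  "\<alpha> \<in> carrier \<pi> \<Longrightarrow> U \<in> component T \<alpha> \<longleftrightarrow> U \<in> Ob T \<and> degree \<pi> T U = \<alpha>"
  using component_Ob degree_eqI degree_component by blast

section \<open>Objects and arrows of the center as pairs and triples\<close>

lemma center_simps [simp]:
  "Ob (center \<pi> T) = center_Ob \<pi> T"
  "Arr (center \<pi> T) = center_Arr \<pi> T"
  "Dom (center \<pi> T) (A, f, B) = A"
  "Cod (center \<pi> T) (A, f, B) = B"
  "Ide (center \<pi> T) A = (A, Ide T (fst A), A)"
  "(B', g, D) \<cdot>\<^bsub>center \<pi> T\<^esub> (A, f, B) = (A, g \<cdot> f, D)"
  "TenO (center \<pi> T) = center_TenO \<pi> T"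
  "(A, f, B) \<star>\<^bsub>center \<pi> T\<^esub> (A', f', B') = (center_TenO \<pi> T A A', f \<star> f', center_TenO \<pi> T B B')"
  "Unit (center \<pi> T) = (Unit T, \<lambda>X \<in> Ob T. Ide T X)"
  "component (center \<pi> T) \<alpha> = {(U, c). half_braiding \<pi> T U c \<and> U \<in> component T \<alpha>}"
  by (simp_all add: center_def)

lemma center_Ob_iff [simp]: "(U, c) \<in> center_Ob \<pi> T \<longleftrightarrow> half_braiding \<pi> T U c"
  by (simp add: center_Ob_def)

lemma center_ObE:
  assumes "A \<in> center_Ob \<pi> T"
  obtains U c where "A = (U, c)" "half_braiding \<pi> T U c"
  using assms by (cases A) auto

lemma center_Arr_Ob:
  assumes "(A, f, B) \<in> center_Arr \<pi> T"
  shows "A \<in> center_Ob \<pi> T" "B \<in> center_Ob \<pi> T" "f \<in> Arr T" "Dom T f = fst A" "Cod T f = fst B"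
  using assms by (cases A; cases B; auto simp: center_Arr_iff)+

lemma center_ArrE:
  assumes "x \<in> center_Arr \<pi> T"
  obtains A f B where "x = (A, f, B)" "(A, f, B) \<in> center_Arr \<pi> T"
    "A \<in> center_Ob \<pi> T" "B \<in> center_Ob \<pi> T" "f \<in> Arr T" "Dom T f = fst A" "Cod T f = fst B"
  using assms center_Arr_Ob by (cases x) blast

lemma homs_centerE:
  assumes "x \<in> homs (center \<pi> T) A B"
  obtains f where "x = (A, f, B)" "(A, f, B) \<in> center_Arr \<pi> T"
    "A \<in> center_Ob \<pi> T" "B \<in> center_Ob \<pi> T" "f \<in> Arr T" "Dom T f = fst A" "Cod T f = fst B"
  using assms center_Arr_Ob by (cases x) (auto simp: homs_def)

lemma homs_center_iff [simp]:
  "(A, f, B) \<in> homs (center \<pi> T) A' B' \<longleftrightarrow> A = A' \<and> B = B' \<and> (A, f, B) \<in> center_Arr \<pi> T"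
  by (auto simp: homs_def)

lemma center_Comp_closed:
  "\<lbrakk>(A, f, B) \<in> center_Arr \<pi> T; (B, g, D) \<in> center_Arr \<pi> T\<rbrakk> \<Longrightarrow> (A, g \<cdot> f, D) \<in> center_Arr \<pi> T"
  by (cases A; cases B; cases D) (simp add: center_Arr_Comp)

lemma center_inverse_closed:
  "\<lbrakk>(A, f, B) \<in> center_Arr \<pi> T; g \<in> homs T (fst B) (fst A);
    g \<cdot> f = Ide T (fst A); f \<cdot> g = Ide T (fst B)\<rbrakk> \<Longrightarrow> (B, g, A) \<in> center_Arr \<pi> T"
  by (cases A; cases B) (simp add: center_Arr_inverse)

lemma center_TenA_closed:
  "\<lbrakk>(A, f, B) \<in> center_Arr \<pi> T; (A', f', B') \<in> center_Arr \<pi> T\<rbrakk> \<Longrightarrow>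
    (center_TenO \<pi> T A A', f \<star> f', center_TenO \<pi> T B B') \<in> center_Arr \<pi> T"
  by (cases A; cases B; cases A'; cases B') (simp add: center_Arr_TenA)

lemma center_conj_arr_closed:
  "\<lbrakk>(A, f, B) \<in> center_Arr \<pi> T; \<beta> \<in> carrier \<pi>\<rbrakk> \<Longrightarrow>
    (center_conj_ob T \<beta> A, conj_arr T \<beta> f, center_conj_ob T \<beta> B) \<in> center_Arr \<pi> T"
  by (cases A; cases B) (simp add: center_Arr_conj)

lemma center_TenO_closed:
  "\<lbrakk>A \<in> center_Ob \<pi> T; B \<in> center_Ob \<pi> T\<rbrakk> \<Longrightarrow> center_TenO \<pi> T A B \<in> center_Ob \<pi> T"
  by (auto elim!: center_ObE simp: center_TenO_eq half_braiding_center_TenO)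

lemma center_conj_ob_closed:
  "\<lbrakk>A \<in> center_Ob \<pi> T; \<beta> \<in> carrier \<pi>\<rbrakk> \<Longrightarrow> center_conj_ob T \<beta> A \<in> center_Ob \<pi> T"
  by (auto elim!: center_ObE simp: center_conj_ob_eq half_braiding_center_conj)

lemma fst_center_TenO [simp]: "fst (center_TenO \<pi> T A B) = fst A \<boxtimes> fst B"
  by (simp add: center_TenO_def case_prod_unfold)

lemma fst_center_conj_ob [simp]: "fst (center_conj_ob T \<beta> A) = conj_ob T \<beta> (fst A)"
  by (simp add: center_conj_ob_def case_prod_unfold)

text \<open>At the object underlying a third half-braiding this is the first hexagon of the
  braiding; the projections let it apply without splitting \<open>A\<close> and \<open>B\<close>
  into pairs.\<close>

lemma snd_center_TenO [simp]:
  "X \<in> Ob T \<Longrightarrow> snd (center_TenO \<pi> T A B) X =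
    (snd A (conj_ob T (degree \<pi> T (fst B)) X) \<star> Ide T (fst B)) \<cdot> (Ide T (fst A) \<star> snd B X)"
  by (cases A; cases B) (simp add: center_TenO_eq)

lemma snd_center_conj_ob [simp]:
  "\<lbrakk>\<beta> \<in> carrier \<pi>; X \<in> Ob T\<rbrakk> \<Longrightarrow>
    snd (center_conj_ob T \<beta> A) X = conj_arr T \<beta> (snd A (conj_ob T (inv\<^bsub>\<pi>\<^esub> \<beta>) X))"
  by (cases A) (simp add: center_conj_ob_eq)

lemma center_Ob_half_braiding: "A \<in> center_Ob \<pi> T \<Longrightarrow> half_braiding \<pi> T (fst A) (snd A)"
  by (auto elim!: center_ObE)

lemma center_Ob_fst: "A \<in> center_Ob \<pi> T \<Longrightarrow> fst A \<in> Ob T"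
  by (auto elim!: center_ObE simp: half_braiding_Ob)

text \<open>Both families send \<open>X\<close> to one composite of three whiskered half-braidings;
  multiplicativity of the degree puts \<open>c\<close> at \<open>\<^sup>V(\<^sup>WX)\<close> in
  either case.\<close>

lemma center_TenO_assoc:
  assumes "A \<in> center_Ob \<pi> T" "B \<in> center_Ob \<pi> T" "D \<in> center_Ob \<pi> T"
  shows "center_TenO \<pi> T (center_TenO \<pi> T A B) D = center_TenO \<pi> T A (center_TenO \<pi> T B D)"
proof -
  from assms obtain U c V d W e where A: "A = (U, c)" "B = (V, d)" "D = (W, e)"
    and hb: "half_braiding \<pi> T U c" "half_braiding \<pi> T V d" "half_braiding \<pi> T W e"
    by (auto elim!: center_ObE)
  note [simp] = hb[THEN half_braiding_Ob] half_braiding_simps[OF hb(1)] half_braiding_simps[OF hb(2)]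
    half_braiding_simps[OF hb(3)]
  show ?thesis
    by (simp add: A center_TenO_eq TenO_assoc restrict_def fun_eq_iff Comp_assoc_Arr TenA_assoc
        whisker_left whisker_right TenA_Ide[symmetric])
qed

lemma center_TenO_Unit:
  assumes "A \<in> center_Ob \<pi> T"
  shows "center_TenO \<pi> T (Unit T, \<lambda>X \<in> Ob T. Ide T X) A = A"
    and "center_TenO \<pi> T A (Unit T, \<lambda>X \<in> Ob T. Ide T X) = A"
proof -
  from assms obtain U c where A: "A = (U, c)" and hb: "half_braiding \<pi> T U c"
    by (auto elim!: center_ObE)
  note [simp] = half_braiding_simps[OF hb]
  \<comment> \<open>Outside the objects the tensor product is \<open>undefined\<close> by
    restriction, and extensionality gives \<open>c\<close> the same value there.\<close>
  have ext: "c X = undefined" if "X \<notin> Ob T" for X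
    using half_braiding_extensional[OF hb] that by (simp add: extensional_def)
  show "center_TenO \<pi> T (Unit T, \<lambda>X \<in> Ob T. Ide T X) A = A"
    "center_TenO \<pi> T A (Unit T, \<lambda>X \<in> Ob T. Ide T X) = A"
    by (auto simp: A center_TenO_eq fun_eq_iff ext TenA_Ide)
qed

text \<open>Let \<open>v\<close> be the degree of \<open>fst B\<close>. On the right,
  \<open>\<beta> v \<beta>^{-1}\<close> and then \<open>\<beta>^{-1}\<close> act on the index of the
  first half-braiding; together they give \<open>v \<beta>^{-1}\<close>, which is how the left side
  shifts it.\<close>

lemma center_conj_ob_TenO:
  assumes "A \<in> center_Ob \<pi> T" "B \<in> center_Ob \<pi> T" "\<beta> \<in> carrier \<pi>"
  shows "center_conj_ob T \<beta> (center_TenO \<pi> T A B) =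
    center_TenO \<pi> T (center_conj_ob T \<beta> A) (center_conj_ob T \<beta> B)"
proof -
  from assms obtain U c V d where A: "A = (U, c)" "B = (V, d)"
    and hb: "half_braiding \<pi> T U c" "half_braiding \<pi> T V d"
    by (auto elim!: center_ObE)
  note [simp] = half_braiding_simps[OF hb(1)] half_braiding_simps[OF hb(2)]
  show ?thesis
    using assms(3) by (auto simp: A center_TenO_eq center_conj_ob_eq fun_eq_iff TenO_assoc)
qed

lemma center_conj_ob_Unit:
  "\<beta> \<in> carrier \<pi> \<Longrightarrow>
    center_conj_ob T \<beta> (Unit T, \<lambda>X \<in> Ob T. Ide T X) = (Unit T, \<lambda>X \<in> Ob T. Ide T X)"
  by (auto simp: center_conj_ob_eq fun_eq_iff)

text \<open>The index is shifted by inverses, and inversion reverses products, so the two shifts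
  compose in the right order.\<close>

lemma center_conj_ob_mult:
  assumes "A \<in> center_Ob \<pi> T" "\<beta> \<in> carrier \<pi>" "\<gamma> \<in> carrier \<pi>"
  shows "center_conj_ob T (\<beta> \<otimes>\<^bsub>\<pi>\<^esub> \<gamma>) A = center_conj_ob T \<beta> (center_conj_ob T \<gamma> A)"
proof -
  from assms obtain U c where A: "A = (U, c)" and hb: "half_braiding \<pi> T U c"
    by (auto elim!: center_ObE)
  note [simp] = half_braiding_simps[OF hb]
  show ?thesis
    using assms(2,3) by (auto simp: A center_conj_ob_eq fun_eq_iff inv_mult_group)
qed

lemma center_conj_ob_one:
  assumes "A \<in> center_Ob \<pi> T"
  shows "center_conj_ob T \<one>\<^bsub>\<pi>\<^esub> A = A"
proof -
  from assms obtain U c where A: "A = (U, c)" and hb: "half_braiding \<pi> T U c"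
    by (auto elim!: center_ObE)
  note [simp] = half_braiding_simps[OF hb]
  have ext: "c X = undefined" if "X \<notin> Ob T" for X
    using half_braiding_extensional[OF hb] that by (simp add: extensional_def)
  show ?thesis
    by (auto simp: A center_conj_ob_eq fun_eq_iff ext)
qed

lemma center_conj_ob_inv:
  assumes "A \<in> center_Ob \<pi> T" "\<beta> \<in> carrier \<pi>"
  shows "center_conj_ob T \<beta> (center_conj_ob T (inv\<^bsub>\<pi>\<^esub> \<beta>) A) = A"
    and "center_conj_ob T (inv\<^bsub>\<pi>\<^esub> \<beta>) (center_conj_ob T \<beta> A) = A"
  using assms by (simp_all add: center_conj_ob_one flip: center_conj_ob_mult)

text \<open>Arrows are composed and tensored as in \<open>T\<close>, so each equation of triples
  splits into the axiom of \<open>T\<close> for the underlying arrows and an equality of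
  endpoints.\<close>

lemma strict_tensor_category_center: "strict_tensor_category (center \<pi> T)"
proof
  let ?Z = "center \<pi> T"
  show "Dom ?Z x \<in> Ob ?Z" "Cod ?Z x \<in> Ob ?Z" if "x \<in> Arr ?Z" for x
    by (rule center_ArrE[OF that[unfolded center_simps]], simp)+
  show "Ide ?Z A \<in> homs ?Z A A" if "A \<in> Ob ?Z" for A
    using that by (cases A) (simp add: center_Arr_Ide)
  show "y \<cdot>\<^bsub>?Z\<^esub> x \<in> homs ?Z A D" if "x \<in> homs ?Z A B" "y \<in> homs ?Z B D" for x y A B D
    using that by (auto elim!: homs_centerE simp: center_Comp_closed)
  show "(z \<cdot>\<^bsub>?Z\<^esub> y) \<cdot>\<^bsub>?Z\<^esub> x = z \<cdot>\<^bsub>?Z\<^esub> (y \<cdot>\<^bsub>?Z\<^esub> x)"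
    if "x \<in> homs ?Z A B" "y \<in> homs ?Z B D" "z \<in> homs ?Z D E" for x y z A B D E
    using that by (auto elim!: homs_centerE simp: Comp_assoc_Arr)
  show "Ide ?Z B \<cdot>\<^bsub>?Z\<^esub> x = x" "x \<cdot>\<^bsub>?Z\<^esub> Ide ?Z A = x" if "x \<in> homs ?Z A B" for x A B
    using that by (auto elim!: homs_centerE)
  show "Unit ?Z \<in> Ob ?Z" by (simp add: half_braiding_Unit)
  show "A \<boxtimes>\<^bsub>?Z\<^esub> B \<in> Ob ?Z" if "A \<in> Ob ?Z" "B \<in> Ob ?Z" for A B
    using that by (simp add: center_TenO_closed)
  show "x \<star>\<^bsub>?Z\<^esub> y \<in> homs ?Z (A \<boxtimes>\<^bsub>?Z\<^esub> B) (A' \<boxtimes>\<^bsub>?Z\<^esub> B')"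
    if "x \<in> homs ?Z A A'" "y \<in> homs ?Z B B'" for x y A A' B B'
    using that by (auto elim!: homs_centerE simp: center_TenA_closed)
  show "Ide ?Z A \<star>\<^bsub>?Z\<^esub> Ide ?Z B = Ide ?Z (A \<boxtimes>\<^bsub>?Z\<^esub> B)" if "A \<in> Ob ?Z" "B \<in> Ob ?Z" for A B
    using that by (simp add: TenA_Ide center_Ob_fst)
  show "(x' \<cdot>\<^bsub>?Z\<^esub> x) \<star>\<^bsub>?Z\<^esub> (y' \<cdot>\<^bsub>?Z\<^esub> y) = (x' \<star>\<^bsub>?Z\<^esub> y') \<cdot>\<^bsub>?Z\<^esub> (x \<star>\<^bsub>?Z\<^esub> y)"
    if "x \<in> homs ?Z A A'" "x' \<in> homs ?Z A' A''" "y \<in> homs ?Z B B'" "y' \<in> homs ?Z B' B''"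
    for x x' y y' A A' A'' B B' B''
    using that by (auto elim!: homs_centerE simp: TenA_Comp_Arr)
  show "(A \<boxtimes>\<^bsub>?Z\<^esub> B) \<boxtimes>\<^bsub>?Z\<^esub> D = A \<boxtimes>\<^bsub>?Z\<^esub> (B \<boxtimes>\<^bsub>?Z\<^esub> D)"
    if "A \<in> Ob ?Z" "B \<in> Ob ?Z" "D \<in> Ob ?Z" for A B D
    using that by (simp add: center_TenO_assoc)
  show "(x \<star>\<^bsub>?Z\<^esub> y) \<star>\<^bsub>?Z\<^esub> z = x \<star>\<^bsub>?Z\<^esub> (y \<star>\<^bsub>?Z\<^esub> z)"
    if "x \<in> Arr ?Z" "y \<in> Arr ?Z" "z \<in> Arr ?Z" for x y z
    by (rule center_ArrE[OF that(1)[unfolded center_simps]], rule center_ArrE[OF that(2)[unfolded center_simps]], rule center_ArrE[OF that(3)[unfolded center_simps]])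
      (simp add: TenA_assoc center_TenO_assoc)
  show "Unit ?Z \<boxtimes>\<^bsub>?Z\<^esub> A = A" "A \<boxtimes>\<^bsub>?Z\<^esub> Unit ?Z = A" if "A \<in> Ob ?Z" for A
    using that by (simp_all add: center_TenO_Unit)
  show "Ide ?Z (Unit ?Z) \<star>\<^bsub>?Z\<^esub> x = x" "x \<star>\<^bsub>?Z\<^esub> Ide ?Z (Unit ?Z) = x" if "x \<in> Arr ?Z" for x
    by (rule center_ArrE[OF that[unfolded center_simps]], simp add: center_TenO_Unit)+
qed

section \<open>The conjugation of the center\<close>

lemma conj_ob_center [simp]:
  "A \<in> center_Ob \<pi> T \<Longrightarrow> conj_ob (center \<pi> T) \<beta> A = center_conj_ob T \<beta> A"
  by (simp add: conj_ob_def center_def)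

lemma conjugation_center: "conjugation (center \<pi> T) \<beta> =
    (\<lambda>A \<in> center_Ob \<pi> T. center_conj_ob T \<beta> A,
     \<lambda>(A, f, B) \<in> center_Arr \<pi> T. (center_conj_ob T \<beta> A, conj_arr T \<beta> f, center_conj_ob T \<beta> B))"
  by (simp add: center_def)

lemma conj_arr_center [simp]:
  "(A, f, B) \<in> center_Arr \<pi> T \<Longrightarrow> conj_arr (center \<pi> T) \<beta> (A, f, B) =
    (center_conj_ob T \<beta> A, conj_arr T \<beta> f, center_conj_ob T \<beta> B)"
  by (simp add: conj_arr_def conjugation_center)

lemma conjugation_center_endo:
  assumes \<beta>: "\<beta> \<in> carrier \<pi>"
  shows "conjugation (center \<pi> T) \<beta> \<in> strict_tensor_endos (center \<pi> T)"
  unfolding strict_tensor_endos_iff conjugation_center fst_conv snd_conv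
proof (intro conjI allI ballI, goal_cases)
  case 1
  then show ?case using \<beta> by (auto simp: center_conj_ob_closed)
next
  case 2
  then show ?case using \<beta> by (auto simp: center_conj_arr_closed)
next
  case (3 A B x)
  then show ?case
    using \<beta> by (auto elim!: homs_centerE simp: center_conj_arr_closed)
next
  case (4 A)
  then show ?case using \<beta> by (cases A) (simp add: center_Arr_Ide center_Ob_fst half_braiding_Ob)
next
  case (5 A B D x y)
  \<comment> \<open>The middle object \<open>B\<close> does not occur in the composite triple, so
    closure under composition is instantiated with it explicitly.\<close>
  then show ?case
    using \<beta> by (auto elim!: homs_centerE simp: center_Comp_closed[of A _ B _ D])
next
  case 6
  then show ?case using \<beta> by (simp add: half_braiding_Unit center_conj_ob_Unit)
next
  case (7 A B)
  then show ?case using \<beta> by (simp add: center_TenO_closed center_conj_ob_TenO)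
next
  case (8 x y)
  then have x: "x \<in> center_Arr \<pi> T" and y: "y \<in> center_Arr \<pi> T" by simp_all
  show ?case
    by (rule center_ArrE[OF x], rule center_ArrE[OF y])
      (simp add: \<beta> center_TenA_closed center_conj_ob_TenO)
qed

text \<open>Invertibility is supplied by \<open>hom_aut_groupI\<close>; what remains are equalities
  of object and arrow maps, also outside the center, where both sides are
  \<open>undefined\<close>.\<close>

lemma conjugation_center_hom: "conjugation (center \<pi> T) \<in> hom \<pi> (aut_group (center \<pi> T))"
proof -
  let ?Z = "center \<pi> T"
  let ?act = "\<lambda>\<beta>. \<lambda>(A, f, B) \<in> center_Arr \<pi> T.
    (center_conj_ob T \<beta> A, conj_arr T \<beta> f, center_conj_ob T \<beta> B)"
  interpret Z: strict_tensor_category ?Z by (rule strict_tensor_category_center)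
  show ?thesis
  proof (rule Z.hom_aut_groupI[OF group_axioms conjugation_center_endo])
    show "conjugation ?Z (\<beta> \<otimes>\<^bsub>\<pi>\<^esub> \<gamma>) = conjugation ?Z \<beta> \<otimes>\<^bsub>endo_monoid ?Z\<^esub> conjugation ?Z \<gamma>"
      if "\<beta> \<in> carrier \<pi>" "\<gamma> \<in> carrier \<pi>" for \<beta> \<gamma>
      unfolding conjugation_center endo_monoid_mult fst_conv snd_conv
    proof (intro arg_cong2[of _ _ _ _ Pair] ext)
      show "(\<lambda>A \<in> center_Ob \<pi> T. center_conj_ob T (\<beta> \<otimes>\<^bsub>\<pi>\<^esub> \<gamma>) A) A =
          compose (Ob ?Z) (\<lambda>A \<in> center_Ob \<pi> T. center_conj_ob T \<beta> A)
            (\<lambda>A \<in> center_Ob \<pi> T. center_conj_ob T \<gamma> A) A" for A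
        using that by (simp add: compose_def center_conj_ob_mult center_conj_ob_closed)
      show "?act (\<beta> \<otimes>\<^bsub>\<pi>\<^esub> \<gamma>) x = compose (Arr ?Z) (?act \<beta>) (?act \<gamma>) x" for x
      proof (cases "x \<in> center_Arr \<pi> T")
        case True
        show ?thesis
          by (rule center_ArrE[OF True])
            (use that in \<open>simp add: compose_def center_conj_ob_mult center_conj_arr_closed\<close>)
      qed (simp add: compose_def)
    qed
    show "conjugation ?Z \<one>\<^bsub>\<pi>\<^esub> = \<one>\<^bsub>endo_monoid ?Z\<^esub>"
      unfolding conjugation_center endo_monoid_def monoid.simps center_simps
    proof (intro arg_cong2[of _ _ _ _ Pair] ext)
      show "?act \<one>\<^bsub>\<pi>\<^esub> x = (\<lambda>x \<in> center_Arr \<pi> T. x) x" for x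
      proof (cases "x \<in> center_Arr \<pi> T")
        case True
        show ?thesis
          by (rule center_ArrE[OF True]) (simp add: center_conj_ob_one)
      qed simp
    qed (simp add: center_conj_ob_one restrict_def)
  qed
qed

lemma strict_T_category_center: "strict_T_category \<pi> (center \<pi> T)"
proof -
  let ?Z = "center \<pi> T"
  interpret Z: strict_tensor_category ?Z by (rule strict_tensor_category_center)
  \<comment> \<open>Components are handled through degrees; \<open>center_simps(10)\<close> is
    removed from simplification wherever it would preempt this form.\<close>
  have component: "A \<in> component ?Z \<alpha> \<longleftrightarrow> A \<in> center_Ob \<pi> T \<and> degree \<pi> T (fst A) = \<alpha>"
    if "\<alpha> \<in> carrier \<pi>" for A \<alpha>
    using that by (cases A) (auto simp: component_iff half_braiding_Ob)
  \<comment> \<open>One endpoint suffices, since arrows of the center preserve the degree.\<close>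
  have component_arr: "(A, f, B) \<in> component_arr ?Z \<alpha> \<longleftrightarrow>
      (A, f, B) \<in> center_Arr \<pi> T \<and> degree \<pi> T (fst A) = \<alpha>" if "\<alpha> \<in> carrier \<pi>" for A f B \<alpha>
    using that center_Arr_degree[of "fst A" "snd A" f "fst B" "snd B"] center_Arr_Ob(1,2)[of A f B]
    unfolding component_arr_def by (simp add: component del: center_simps(10)) blast
  \<comment> \<open>Preimages under conjugation by \<open>\<beta>\<close> are found by conjugating
    with its inverse; this computes the degree in which they land.\<close>
  have inv_conj: "inv\<^bsub>\<pi>\<^esub> \<beta> \<otimes>\<^bsub>\<pi>\<^esub> (\<beta> \<otimes>\<^bsub>\<pi>\<^esub> \<alpha> \<otimes>\<^bsub>\<pi>\<^esub> inv\<^bsub>\<pi>\<^esub> \<beta>) \<otimes>\<^bsub>\<pi>\<^esub> \<beta> = \<alpha>"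
    if "\<alpha> \<in> carrier \<pi>" "\<beta> \<in> carrier \<pi>" for \<alpha> \<beta>
    using that by (simp add: m_assoc) (simp flip: m_assoc)
  show ?thesis
  proof
    show "(\<Union>\<alpha> \<in> carrier \<pi>. component ?Z \<alpha>) = Ob ?Z"
      by (auto simp: component half_braiding_Ob elim!: center_ObE simp del: center_simps(10))
    have "\<exists>\<alpha> \<in> carrier \<pi>. x \<in> component_arr ?Z \<alpha>" if "x \<in> center_Arr \<pi> T" for x
      by (rule center_ArrE[OF that[unfolded center_simps]]) (simp add: component_arr center_Ob_fst)
    then show "(\<Union>\<alpha> \<in> carrier \<pi>. component_arr ?Z \<alpha>) = Arr ?Z"
      by (auto simp: component_arr)
    show "disjoint_family_on (component ?Z) (carrier \<pi>)"
      unfolding disjoint_family_on_def by (auto simp: component simp del: center_simps(10))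
    show "A \<boxtimes>\<^bsub>?Z\<^esub> B \<in> component ?Z (\<alpha> \<otimes>\<^bsub>\<pi>\<^esub> \<beta>)"
      if "\<alpha> \<in> carrier \<pi>" "\<beta> \<in> carrier \<pi>" "A \<in> component ?Z \<alpha>" "B \<in> component ?Z \<beta>" for \<alpha> \<beta> A B
      using that
      by (auto simp: component center_TenO_closed center_Ob_fst simp del: center_simps(10))
    show "conjugation ?Z \<in> hom \<pi> (aut_group ?Z)" by (rule conjugation_center_hom)
    fix \<alpha> \<beta> assume \<alpha>: "\<alpha> \<in> carrier \<pi>" and \<beta>: "\<beta> \<in> carrier \<pi>"
    let ?\<alpha>' = "\<beta> \<otimes>\<^bsub>\<pi>\<^esub> \<alpha> \<otimes>\<^bsub>\<pi>\<^esub> inv\<^bsub>\<pi>\<^esub> \<beta>"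
    have \<alpha>': "?\<alpha>' \<in> carrier \<pi>" using \<alpha> \<beta> by simp
    show "conj_ob ?Z \<beta> ` component ?Z \<alpha> = component ?Z ?\<alpha>'"
    proof
      show "conj_ob ?Z \<beta> ` component ?Z \<alpha> \<subseteq> component ?Z ?\<alpha>'"
        using \<alpha> \<beta> \<alpha>'
        by (auto simp: component center_conj_ob_closed center_Ob_fst half_braiding_Ob
            simp del: center_simps(10))
    next
      show "component ?Z ?\<alpha>' \<subseteq> conj_ob ?Z \<beta> ` component ?Z \<alpha>"
      proof
        fix A assume A: "A \<in> component ?Z ?\<alpha>'"
        then have "center_conj_ob T (inv\<^bsub>\<pi>\<^esub> \<beta>) A \<in> component ?Z \<alpha>"
          "conj_ob ?Z \<beta> (center_conj_ob T (inv\<^bsub>\<pi>\<^esub> \<beta>) A) = A"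
          using \<alpha> \<beta> \<alpha>'
          by (simp_all add: component center_conj_ob_closed center_Ob_fst inv_conj center_conj_ob_inv
              del: center_simps(10))
        then show "A \<in> conj_ob ?Z \<beta> ` component ?Z \<alpha>" by force
      qed
    qed
    show "conj_arr ?Z \<beta> ` component_arr ?Z \<alpha> = component_arr ?Z ?\<alpha>'"
    proof
      show "conj_arr ?Z \<beta> ` component_arr ?Z \<alpha> \<subseteq> component_arr ?Z ?\<alpha>'"
      proof
        fix x assume "x \<in> conj_arr ?Z \<beta> ` component_arr ?Z \<alpha>"
        then obtain A f B where x: "x = conj_arr ?Z \<beta> (A, f, B)"
          and y: "(A, f, B) \<in> component_arr ?Z \<alpha>"
          by force
        then have "(A, f, B) \<in> center_Arr \<pi> T" "degree \<pi> T (fst A) = \<alpha>" "fst A \<in> Ob T"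
          using \<alpha> center_Arr_Ob(1)[of A f B] by (auto simp: component_arr center_Ob_fst)
        then show "x \<in> component_arr ?Z ?\<alpha>'"
          using \<beta> \<alpha>' by (simp add: x component_arr center_conj_arr_closed)
      qed
    next
      show "component_arr ?Z ?\<alpha>' \<subseteq> conj_arr ?Z \<beta> ` component_arr ?Z \<alpha>"
      proof
        fix x assume x: "x \<in> component_arr ?Z ?\<alpha>'"
        obtain A f B where x_eq: "x = (A, f, B)" by (cases x)
        let ?y = "(center_conj_ob T (inv\<^bsub>\<pi>\<^esub> \<beta>) A, conj_arr T (inv\<^bsub>\<pi>\<^esub> \<beta>) f,
          center_conj_ob T (inv\<^bsub>\<pi>\<^esub> \<beta>) B)"
        have "(A, f, B) \<in> center_Arr \<pi> T" "degree \<pi> T (fst A) = ?\<alpha>'"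
          using x \<alpha>' by (simp_all add: x_eq component_arr)
        moreover from this have "A \<in> center_Ob \<pi> T" "B \<in> center_Ob \<pi> T" "f \<in> Arr T" "fst A \<in> Ob T"
          using center_Arr_Ob[of A f B] center_Ob_fst by simp_all
        ultimately have "?y \<in> component_arr ?Z \<alpha>" "conj_arr ?Z \<beta> ?y = x"
          using \<alpha> \<beta>
          by (simp_all add: x_eq component_arr center_conj_arr_closed inv_conj center_conj_ob_inv)
        then show "x \<in> conj_arr ?Z \<beta> ` component_arr ?Z \<alpha>" by force
      qed
    qed
  qed
qed


section \<open>The braiding of the center\<close>

lemma braided_T_category_center: "braided_T_category \<pi> (center \<pi> T) (center_braiding \<pi> T)"
proof -
  let ?Z = "center \<pi> T" and ?b = "center_braiding \<pi> T"
  interpret Z: strict_T_category \<pi> ?Z by (rule strict_T_category_center)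
  \<comment> \<open>Components of the center are cut out by the underlying object, so both
    descriptions single out the same group element.\<close>
  have deg: "degree \<pi> ?Z A = degree \<pi> T (fst A)" if "A \<in> center_Ob \<pi> T" for A
    using that by (cases A) (simp add: degree_def)
  have act: "act_ob \<pi> ?Z A B = center_conj_ob T (degree \<pi> T (fst A)) B"
    if "A \<in> center_Ob \<pi> T" "B \<in> center_Ob \<pi> T" for A B
    using that by (simp add: act_ob_def deg)
  have b_eq: "?b A B = (center_TenO \<pi> T A B, snd A (fst B),
      center_TenO \<pi> T (center_conj_ob T (degree \<pi> T (fst A)) B) A)"
    if "A \<in> center_Ob \<pi> T" "B \<in> center_Ob \<pi> T" for A B
    using that by (simp add: center_braiding_def act)
  have b_Arr: "(center_TenO \<pi> T A B, snd A (fst B),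
      center_TenO \<pi> T (center_conj_ob T (degree \<pi> T (fst A)) B) A) \<in> center_Arr \<pi> T"
    if "A \<in> center_Ob \<pi> T" "B \<in> center_Ob \<pi> T" for A B
    using that by (auto elim!: center_ObE simp: center_Arr_half_braiding)
  show ?thesis
  proof
    show "?b A B \<in> homs ?Z (A \<boxtimes>\<^bsub>?Z\<^esub> B) (act_ob \<pi> ?Z A B \<boxtimes>\<^bsub>?Z\<^esub> A)"
      if "A \<in> Ob ?Z" "B \<in> Ob ?Z" for A B
      using that b_Arr[of A B] by (simp add: b_eq act)
    show "is_iso ?Z (?b A B)" if "A \<in> Ob ?Z" "B \<in> Ob ?Z" for A B
    proof -
      obtain U c V d where A: "A = (U, c)" "B = (V, d)"
        and hb: "half_braiding \<pi> T U c" "half_braiding \<pi> T V d"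
        using \<open>A \<in> Ob ?Z\<close> \<open>B \<in> Ob ?Z\<close> by (auto elim!: center_ObE)
      note [simp] = half_braiding_simps[OF hb(1)] half_braiding_simps[OF hb(2)]
      let ?D = "center_TenO \<pi> T A B"
      let ?E = "center_TenO \<pi> T (center_conj_ob T (degree \<pi> T U) B) A"
      have cV: "c V \<in> homs T (fst ?D) (fst ?E)"
        by (simp add: A homs_def)
      obtain g where g: "g \<in> homs T (fst ?E) (fst ?D)" "g \<cdot> c V = Ide T (fst ?D)"
          "c V \<cdot> g = Ide T (fst ?E)"
        using is_isoE[OF half_braiding_is_iso[OF hb(1)] cV] by auto
      have f: "(?D, c V, ?E) \<in> center_Arr \<pi> T"
        using b_Arr[of A B] hb by (simp add: A)
      then have "(?E, g, ?D) \<in> center_Arr \<pi> T"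
        by (rule center_inverse_closed[OF _ g])
      then have "is_iso ?Z (?D, c V, ?E)"
        using f g by (intro Z.is_isoI[of _ ?D ?E "(?E, g, ?D)"]) simp_all
      then show ?thesis using hb by (simp add: b_eq A)
    qed
    show "(conj_arr ?Z \<alpha> y \<star>\<^bsub>?Z\<^esub> x) \<cdot>\<^bsub>?Z\<^esub> ?b A B = ?b A' B' \<cdot>\<^bsub>?Z\<^esub> (x \<star>\<^bsub>?Z\<^esub> y)"
      if \<alpha>: "\<alpha> \<in> carrier \<pi>" and "A \<in> component ?Z \<alpha>" "A' \<in> component ?Z \<alpha>"
        and x: "x \<in> homs ?Z A A'" and y: "y \<in> homs ?Z B B'" for \<alpha> A A' x y B B'
    proof -
      obtain f g where xy: "x = (A, f, A')" "y = (B, g, B')"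
        and f: "(A, f, A') \<in> center_Arr \<pi> T" and g: "(B, g, B') \<in> center_Arr \<pi> T"
        using x y by (auto elim!: homs_centerE)
      obtain U c where A: "A = (U, c)" and hb: "half_braiding \<pi> T U c"
        by (rule center_ObE[OF center_Arr_Ob(1)[OF f]])
      obtain U' c' where A': "A' = (U', c')" and hb': "half_braiding \<pi> T U' c'"
        by (rule center_ObE[OF center_Arr_Ob(2)[OF f]])
      note [simp] = center_Arr_Ob[OF f] center_Arr_Ob[OF g] A A'
        half_braiding_simps[OF hb] half_braiding_simps[OF hb'] \<alpha>
      let ?V = "fst B" and ?V' = "fst B'"
      have [simp]: "?V \<in> Ob T" "?V' \<in> Ob T"
        using center_Ob_fst by simp_all
      have [simp]: "Dom T f = U" "Cod T f = U'" using center_Arr_Ob(4,5)[OF f] by simp_all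
      \<comment> \<open>Both ends of \<open>x\<close> lie in one component, so \<open>c\<close> and
        \<open>c'\<close> are half-braidings for the same action.\<close>
      have [simp]: "degree \<pi> T U = \<alpha>" "degree \<pi> T U' = \<alpha>"
        using that by (auto simp: degree_eqI)
      \<comment> \<open>First \<open>f\<close> is moved by its arrow condition at \<open>?V\<close>,
        which replaces \<open>c\<close> by \<open>c'\<close>; then \<open>g\<close> is moved by
        naturality of \<open>c'\<close>.\<close>
      have "(conj_arr T \<alpha> g \<star> f) \<cdot> c ?V =
          (conj_arr T \<alpha> g \<star> Ide T U') \<cdot> ((Ide T (conj_ob T \<alpha> ?V) \<star> f) \<cdot> c ?V)"
        by (simp add: interchange_right_first flip: Comp_assoc_Arr)
      also have "(Ide T (conj_ob T \<alpha> ?V) \<star> f) \<cdot> c ?V = c' ?V \<cdot> (f \<star> Ide T ?V)"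
        using f by (simp add: center_Arr_iff)
      also have "(conj_arr T \<alpha> g \<star> Ide T U') \<cdot> (c' ?V \<cdot> (f \<star> Ide T ?V)) =
          ((conj_arr T \<alpha> g \<star> Ide T U') \<cdot> c' ?V) \<cdot> (f \<star> Ide T ?V)"
        by (simp add: Comp_assoc_Arr)
      also have "(conj_arr T \<alpha> g \<star> Ide T U') \<cdot> c' ?V = c' ?V' \<cdot> (Ide T U' \<star> g)"
        using half_braiding_natural[OF hb', of g ?V ?V'] by simp
      also have "(c' ?V' \<cdot> (Ide T U' \<star> g)) \<cdot> (f \<star> Ide T ?V) = c' ?V' \<cdot> (f \<star> g)"
        by (simp add: Comp_assoc_Arr interchange_left_first)
      finally show ?thesis
        using f g hb hb' by (simp add: xy b_eq)
    qed
    \<comment> \<open>The endpoints must also coincide as half-braidings; this is multiplicativity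
      of the conjugation together with strict associativity.\<close>
    show "?b (A \<boxtimes>\<^bsub>?Z\<^esub> B) D = (?b A (act_ob \<pi> ?Z B D) \<star>\<^bsub>?Z\<^esub> Ide ?Z B) \<cdot>\<^bsub>?Z\<^esub> (Ide ?Z A \<star>\<^bsub>?Z\<^esub> ?b B D)"
      if "A \<in> Ob ?Z" "B \<in> Ob ?Z" "D \<in> Ob ?Z" for A B D
      using that
      by (simp add: b_eq act center_TenO_closed center_conj_ob_closed center_TenO_assoc center_Ob_fst
          center_conj_ob_mult)
    \<comment> \<open>Here the endpoints coincide because conjugation respects the tensor product of
      half-braidings strictly.\<close>
    show "?b A (B \<boxtimes>\<^bsub>?Z\<^esub> D) = (Ide ?Z (act_ob \<pi> ?Z A B) \<star>\<^bsub>?Z\<^esub> ?b A D) \<cdot>\<^bsub>?Z\<^esub> (?b A B \<star>\<^bsub>?Z\<^esub> Ide ?Z D)"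
      if "A \<in> Ob ?Z" "B \<in> Ob ?Z" "D \<in> Ob ?Z" for A B D
      using that
      by (simp add: b_eq act center_TenO_closed center_conj_ob_closed center_TenO_assoc center_Ob_fst
          center_conj_ob_TenO half_braiding_TenO[OF center_Ob_half_braiding])
    \<comment> \<open>At the conjugate of \<open>fst B\<close> the index shift cancels, leaving the
      conjugate of the value at \<open>fst B\<close>. With \<open>u\<close> the degree of
      \<open>fst A\<close>, the targets agree because
      \<open>(\<beta> u \<beta>^{-1}) \<beta> = \<beta> u\<close>.\<close>
    show "conj_arr ?Z \<beta> (?b A B) = ?b (conj_ob ?Z \<beta> A) (conj_ob ?Z \<beta> B)"
      if "\<beta> \<in> carrier \<pi>" "A \<in> Ob ?Z" "B \<in> Ob ?Z" for \<beta> A B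
      using that
      by (simp add: b_eq b_Arr center_conj_ob_closed center_TenO_closed center_conj_ob_TenO
          center_Ob_fst center_conj_ob_mult center_conj_ob_inv)
  qed
qed

end


theorem mainTheorem3:
  fixes \<pi> :: "('p, 'g) monoid_scheme" and T :: "('p, 'o, 'a, 'm) T_cat_scheme"
  assumes "strict_T_category \<pi> T"
  shows "braided_T_category \<pi> (center \<pi> T) (center_braiding \<pi> T)"
  using assms by (rule strict_T_category.braided_T_category_center)

end
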